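(* Let $n\ge1$ and $\alpha\in\mathbb{R}\setminus\pi\mathbb{Z}$. For every $f\in L^2(\mathbb{R}^n)$, $$f=\sum_{k\in\mathbb{Z}}D_k^\alpha(f)$$ both almost everywhere and in $L^2(\mathbb{R}^n)$, and $$\|f\|_{L^2(\mathbb{R}^n)}^2=\sum_{k\in\mathbb{Z}}\|D_k^\alpha(f)\|_{L^2(\mathbb{R}^n)}^2.$$ In one dimension ($n=1$), $$f=\sum_{I\in\mathcal D}\langle f,h_I^\alpha\rangle h_I^\alpha\qquad\text{and}\qquad\|f\|_{L^2(\mathbb{R})}^2=\sum_{I\in\mathcal D}|\langle f,h_I^\alpha\rangle|^2 .$$
   Context: $M_\alpha f(x)=e^{i\pi|x|^2\cot\alpha}f(x)$ and $M_\alpha^{-1}$ is multiplication by $e^{-i\pi|x|^2\cot\alpha}$. $E_k$ is the classical dyadic conditional expectation: $E_k g(x)$ is the average of $g$ over the dyadic cube of side length $2^{-k}$ containing $x$; $D_k:=E_k-E_{k-1}$ is the martingale difference operator. The twisted operator is $D_k^\alpha:=M_\alpha^{-1}D_kM_\alpha$. Sums over $k\in\mathbb{Z}$ are limits of the partial sums over $|k|\le N$ as $N\to\infty$. In dimension one, $\mathcal D$ is the set of all dyadic intervals, $\mathcal D_{k}$ is the set of those of length $2^{-k}$, $h_I=|I|^{-1/2}(\chi_{I_L}-\chi_{I_R})$ is the $L^2$-normalized Haar function of $I\in\mathcal D$ ($I_L,I_R$ the left and right halves of $I$), and $h_I^\alpha:=M_\alpha^{-1}h_I=e^{-i\pi x^2\cot\alpha}h_I(x)$.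 $\langle f,g\rangle=\int f\,\overline g$. The one-dimensional expansion of $f$ is understood, like the first one, both almost everywhere and in $L^2(\mathbb{R})$, the sum over $\mathcal D$ being taken generation by generation, $\sum_{k\in\mathbb{Z}}\sum_{I\in\mathcal D_{k-1}}$, where $D_k^\alpha(f)=\sum_{I\in\mathcal D_{k-1}}\langle f,h_I^\alpha\rangle h_I^\alpha$. *)

theory Defs
  imports "HOL-Analysis.Analysis"
begin

text \<open>
  Elements of \<open>L\<^sup>2\<close> are represented by functions, not by classes modulo null sets.
  All operators below act on representatives.
\<close>

definition L2_space :: "('a::euclidean_space \<Rightarrow> complex) set" where
  "L2_space = {f \<in> borel_measurable lebesgue. integrable lebesgue (\<lambda>x. (cmod (f x))\<^sup>2)}"

definition L2_norm :: "('a::euclidean_space \<Rightarrow> complex) \<Rightarrow> real" where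
  "L2_norm f = sqrt (LINT x|lebesgue. (cmod (f x))\<^sup>2)"

definition L2_inner :: "('a::euclidean_space \<Rightarrow> complex) \<Rightarrow> ('a \<Rightarrow> complex) \<Rightarrow> complex" where
  "L2_inner f g = (LINT x|lebesgue. f x * cnj (g x))"

text \<open>
  The membership condition is needed because the Bochner integral of a non-integrable function
  is \<open>0\<close>, so that \<^const>\<open>L2_norm\<close> says nothing outside \<^const>\<open>L2_space\<close>.
\<close>

definition L2_tendsto ::
    "('i \<Rightarrow> 'a::euclidean_space \<Rightarrow> complex) \<Rightarrow> ('a \<Rightarrow> complex) \<Rightarrow> 'i filter \<Rightarrow> bool" where
  "L2_tendsto F f net \<longleftrightarrow>
     (\<forall>\<^sub>F i in net. (\<lambda>x. F i x - f x) \<in> L2_space) \<and>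
     ((\<lambda>i. L2_norm (\<lambda>x. F i x - f x)) \<longlongrightarrow> 0) net"

definition chirp :: "real \<Rightarrow> ('a::euclidean_space \<Rightarrow> complex) \<Rightarrow> 'a \<Rightarrow> complex" where
  "chirp \<alpha> f x = exp (\<i> * complex_of_real (pi * (norm x)\<^sup>2 * cot \<alpha>)) * f x"

definition chirp_inv :: "real \<Rightarrow> ('a::euclidean_space \<Rightarrow> complex) \<Rightarrow> 'a \<Rightarrow> complex" where
  "chirp_inv \<alpha> f x = exp (- \<i> * complex_of_real (pi * (norm x)\<^sup>2 * cot \<alpha>)) * f x"

text \<open>
  Dyadic cubes are half-open, so that those of one generation partition the space. On the type
  \<^typ>\<open>real\<close> they are the dyadic intervals \<open>[m 2\<^sup>-\<^sup>k, (m + 1) 2\<^sup>-\<^sup>k)\<close>.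
\<close>

definition dyadic_cubes :: "int \<Rightarrow> 'a::euclidean_space set set" where
  "dyadic_cubes k =
     range (\<lambda>m :: 'a \<Rightarrow> int.
       {x. \<forall>b\<in>Basis. of_int (m b) * 2 powi (- k) \<le> x \<bullet> b \<and>
                     x \<bullet> b < (of_int (m b) + 1) * 2 powi (- k)})"

lemma ex1_dyadic_cube: "\<exists>!Q. Q \<in> dyadic_cubes k \<and> (x :: 'a::euclidean_space) \<in> Q"
proof -
  define C where "C = (\<lambda>m :: 'a \<Rightarrow> int.
       {x. \<forall>b\<in>Basis. of_int (m b) * 2 powi (- k) \<le> x \<bullet> b \<and>
                     x \<bullet> b < (of_int (m b) + 1) * 2 powi (- k)})"
  have iff: "y \<in> C m \<longleftrightarrow> (\<forall>b\<in>Basis. m b = \<lfloor>(y \<bullet> b) * 2 powi k\<rfloor>)" for y m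
  proof -
    have "of_int (m b) * 2 powi (- k) \<le> y \<bullet> b \<and> y \<bullet> b < (of_int (m b) + 1) * 2 powi (- k)
          \<longleftrightarrow> m b = \<lfloor>(y \<bullet> b) * 2 powi k\<rfloor>" for b
      unfolding eq_commute[of "m b"] floor_eq_iff by (simp add: power_int_minus field_simps)
    then show ?thesis unfolding C_def by simp
  qed
  have "x \<in> C (\<lambda>b. \<lfloor>(x \<bullet> b) * 2 powi k\<rfloor>)"
    by (simp add: iff)
  moreover have "C m = C m'" if "x \<in> C m" "x \<in> C m'" for m m'
    using that by (auto simp: iff)
  moreover have "dyadic_cubes k = range C"
    unfolding dyadic_cubes_def C_def ..
  ultimately show ?thesis by auto
qed

definition dyadic_cube_at :: "int \<Rightarrow> 'a::euclidean_space \<Rightarrow> 'a set" where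
  "dyadic_cube_at k x = (THE Q. Q \<in> dyadic_cubes k \<and> x \<in> Q)"

definition dyadic_E :: "int \<Rightarrow> ('a::euclidean_space \<Rightarrow> complex) \<Rightarrow> 'a \<Rightarrow> complex" where
  "dyadic_E k g x =
     (LINT y:dyadic_cube_at k x|lebesgue. g y) /
       complex_of_real (measure lebesgue (dyadic_cube_at k x))"

definition dyadic_D :: "int \<Rightarrow> ('a::euclidean_space \<Rightarrow> complex) \<Rightarrow> 'a \<Rightarrow> complex" where
  "dyadic_D k g x = dyadic_E k g x - dyadic_E (k - 1) g x"

definition twisted_D :: "real \<Rightarrow> int \<Rightarrow> ('a::euclidean_space \<Rightarrow> complex) \<Rightarrow> 'a \<Rightarrow> complex" where
  "twisted_D \<alpha> k f = chirp_inv \<alpha> (dyadic_D k (chirp \<alpha> f))"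

definition left_half :: "real set \<Rightarrow> real set" where
  "left_half I = {x \<in> I. x < (Inf I + Sup I) / 2}"

definition right_half :: "real set \<Rightarrow> real set" where
  "right_half I = {x \<in> I. x \<ge> (Inf I + Sup I) / 2}"

definition haar :: "real set \<Rightarrow> real \<Rightarrow> complex" where
  "haar I x =
     complex_of_real ((indicator (left_half I) x - indicator (right_half I) x) /
                      sqrt (measure lebesgue I))"

definition twisted_haar :: "real \<Rightarrow> real set \<Rightarrow> real \<Rightarrow> complex" where
  "twisted_haar \<alpha> I = chirp_inv \<alpha> (haar I)"

end

theory Submission
  imports Defs
begin

text \<open>
  Multiplication by a chirp is unimodular, so the problem reduces to the untwisted operators acting on
  \<open>g = M\<^sub>\<alpha> f\<close>, whose partial sums telescope to \<open>E\<^sub>N g - E\<^bsub>-N-1\<^esub> g\<close>. The averages \<open>E\<^sub>k g\<close> converge to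
  \<open>g\<close> almost everywhere as \<open>k \<rightarrow> \<infinity>\<close> (dyadic Lebesgue differentiation) and to \<open>0\<close> everywhere as
  \<open>k \<rightarrow> -\<infinity>\<close> (Cauchy-Schwarz on a cube). Both pointwise limits are upgraded to \<open>L\<^sup>2\<close> by Fatou's lemma and the
  Pythagorean identity \<open>\<parallel>E\<^sub>k g\<parallel>\<^sup>2 = \<parallel>E\<^sub>j g\<parallel>\<^sup>2 + \<parallel>E\<^sub>k g - E\<^sub>j g\<parallel>\<^sup>2\<close> for \<open>j \<le> k\<close>, without any density
  argument in \<open>L\<^sup>2\<close>. In dimension one \<open>D\<^sub>k g\<close> coincides on each \<open>I \<in> \<D>\<^bsub>k-1\<^esub>\<close> with \<open>\<langle>g, h\<^sub>I\<rangle> h\<^sub>I\<close>.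
\<close>

section \<open>Dyadic cubes\<close>

text \<open>Differentiation is an \<open>L^1\<close> statement, while an \<open>L^2\<close> function
  on a space of infinite measure need not be integrable. For k >= 0 the average at x sees only the
  unit cube of generation 0 around x, so differentiation is applied to \<open>g\<close> cut off to
  each of the countably many unit cubes. The restriction to k >= 0 also provides a first generation
  for the stopping-time argument behind the maximal bound. The Pythagorean identity makes the
  squared norms of the averages monotone in k, hence convergent, and turns a gap between two squared
  norms into a squared distance. At the fine end Fatou excludes a loss of norm in the limit. At the
  coarse end Fatou applied to the averages themselves would only say that the limit is nonnegative,
  so it is applied to \<open>E_0 g - E_{-n} g\<close>. Norm identities are assembled cube by cube in
  \<open>ennreal\<close>, where a countable decomposition raises no question of summability. The
  expansion is proved on an arbitrary Euclidean space and then used on both \<open>real ^ 'n\<close>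
  and \<open>real\<close>.\<close>

lemma dyadic_cube_at_altdef:
  "dyadic_cube_at k x = {y. \<forall>b\<in>Basis. \<lfloor>(y \<bullet> b) * 2 powi k\<rfloor> = \<lfloor>(x \<bullet> b) * 2 powi k\<rfloor>}"
    (is "_ = ?C x")
proof -
  have iff: "of_int m * 2 powi (- k) \<le> t \<and> t < (of_int m + 1) * 2 powi (- k)
          \<longleftrightarrow> \<lfloor>t * 2 powi k\<rfloor> = m" for m and t :: real
    unfolding floor_eq_iff by (simp add: power_int_minus field_simps)
  have "?C x \<in> dyadic_cubes k"
    unfolding dyadic_cubes_def iff by (rule image_eqI[of _ _ "\<lambda>b. \<lfloor>(x \<bullet> b) * 2 powi k\<rfloor>"]) auto
  moreover have "x \<in> ?C x" by simp
  ultimately show ?thesis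
    unfolding dyadic_cube_at_def using ex1_dyadic_cube[of k x] by (metis (no_types, lifting) the1_equality)
qed

lemma dyadic_cube_at_in_dyadic_cubes: "dyadic_cube_at k x \<in> dyadic_cubes k"
  and mem_dyadic_cube_at [simp]: "x \<in> dyadic_cube_at k x"
  unfolding dyadic_cube_at_def using theI'[OF ex1_dyadic_cube[of k x]] by auto

lemma dyadic_cube_at_eqI: "Q \<in> dyadic_cubes k \<Longrightarrow> x \<in> Q \<Longrightarrow> dyadic_cube_at k x = Q"
  unfolding dyadic_cube_at_def using ex1_dyadic_cube[of k x] by (metis (no_types, lifting) the1_equality)

lemma dyadic_cubes_eq_range:
  "dyadic_cubes k = range (dyadic_cube_at k :: 'a::euclidean_space \<Rightarrow> 'a set)"
proof (intro equalityI subsetI)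
  fix Q :: "'a set" assume Q: "Q \<in> dyadic_cubes k"
  then obtain m where m: "Q = {x. \<forall>b\<in>Basis. of_int (m b) * 2 powi (- k) \<le> x \<bullet> b \<and>
                     x \<bullet> b < (of_int (m b) + 1) * 2 powi (- k)}"
    unfolding dyadic_cubes_def by blast
  \<comment> \<open>The lower corner is a point of the cube because the lower inequalities are not
    strict.\<close>
  have "(\<Sum>b\<in>Basis. (of_int (m b) * 2 powi (- k)) *\<^sub>R b) \<in> Q"
    unfolding m by (simp add: inner_sum_left_Basis)
  from dyadic_cube_at_eqI[OF Q this] show "Q \<in> range (dyadic_cube_at k)" by blast
qed (auto simp: dyadic_cube_at_in_dyadic_cubes)

lemma dyadic_cube_at_eq_iff: "dyadic_cube_at k y = dyadic_cube_at k x \<longleftrightarrow> y \<in> dyadic_cube_at k x"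
  using dyadic_cube_at_eqI[OF dyadic_cube_at_in_dyadic_cubes] mem_dyadic_cube_at by metis

text \<open>The floor of \<open>t * 2 powi j\<close> is an integer quotient of the floor of
  \<open>t * 2 powi k\<close>, so the index of the fine cube determines that of the coarse
  one.\<close>

lemma dyadic_cube_at_nested:
  assumes "j \<le> k"
  shows "dyadic_cube_at k x \<subseteq> dyadic_cube_at j x"
proof -
  have "\<lfloor>t * 2 powi j\<rfloor> = \<lfloor>t * 2 powi k\<rfloor> div 2 ^ nat (k - j)" for t :: real
  proof -
    have "t * 2 powi j = t * 2 powi k / real (2 ^ nat (k - j))"
      using assms power_int_add[of "2::real" j "k - j"] by (simp add: power_int_def field_simps)
    then show ?thesis
      using floor_divide_real_eq_div[of "2 ^ nat (k - j)" "t * 2 powi k"] by simp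
  qed
  then show ?thesis unfolding dyadic_cube_at_altdef by auto
qed

text \<open>The index functions live on the whole type and are uncountably many. Only their values
  on the finite set \<open>Basis\<close> matter, and those restrictions are countably many.\<close>

lemma countable_dyadic_cubes: "countable (dyadic_cubes k :: 'a::euclidean_space set set)"
proof -
  let ?C = "\<lambda>m :: 'a \<Rightarrow> int.
       {x. \<forall>b\<in>Basis. of_int (m b) * 2 powi (- k) \<le> x \<bullet> b \<and>
                     x \<bullet> b < (of_int (m b) + 1) * 2 powi (- k)}"
  have "dyadic_cubes k \<subseteq> ?C ` (Basis \<rightarrow>\<^sub>E UNIV)"
  proof
    fix Q :: "'a set" assume "Q \<in> dyadic_cubes k"
    then obtain m where m: "Q = ?C m" unfolding dyadic_cubes_def by blast
    show "Q \<in> ?C ` (Basis \<rightarrow>\<^sub>E UNIV)"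
      by (rule image_eqI[of _ _ "restrict m Basis"]) (auto simp: m)
  qed
  then show ?thesis
    by (rule countable_subset) (auto intro!: countable_image countable_PiE)
qed

text \<open>An open and a closed box with the same edges have equal volume, so this sandwich
  determines the measure of the half-open cube.\<close>

lemma dyadic_cube_between_boxes:
  fixes Q :: "'a::euclidean_space set"
  assumes "Q \<in> dyadic_cubes k"
  obtains a where "box a (a + (2 powi (-k)) *\<^sub>R One) \<subseteq> Q" "Q \<subseteq> cbox a (a + (2 powi (-k)) *\<^sub>R One)"
proof -
  obtain m where m: "Q = {x. \<forall>b\<in>Basis. of_int (m b) * 2 powi (- k) \<le> x \<bullet> b \<and>
                     x \<bullet> b < (of_int (m b) + 1) * 2 powi (- k)}"
    using assms unfolding dyadic_cubes_def by blast
  let ?a = "\<Sum>b\<in>Basis. (of_int (m b) * 2 powi (- k)) *\<^sub>R b :: 'a"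
  show ?thesis
    by (rule that[of ?a])
      (auto simp: m box_def cbox_def inner_sum_left_Basis algebra_simps intro: less_imp_le)
qed

lemma sets_dyadic_cube:
  fixes Q :: "'a::euclidean_space set"
  assumes "Q \<in> dyadic_cubes k"
  shows "Q \<in> sets lebesgue"
proof -
  have "{x. \<forall>b\<in>Basis. of_int (m b) * 2 powi (- k) \<le> x \<bullet> b \<and>
                     x \<bullet> b < (of_int (m b) + 1) * 2 powi (- k)} \<in> sets lborel" for m :: "'a \<Rightarrow> int"
    by measurable
  then show ?thesis using assms unfolding dyadic_cubes_def by auto
qed

lemma emeasure_dyadic_cube:
  fixes Q :: "'a::euclidean_space set"
  assumes "Q \<in> dyadic_cubes k"
  shows "emeasure lebesgue Q = ennreal ((2 powi (- k)) ^ DIM('a))"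
proof -
  obtain a where a: "box a (a + (2 powi (-k)) *\<^sub>R One) \<subseteq> Q" "Q \<subseteq> cbox a (a + (2 powi (-k)) *\<^sub>R One)"
    using dyadic_cube_between_boxes[OF assms] .
  have "emeasure lebesgue (box a (a + (2 powi (-k)) *\<^sub>R One)) = ennreal ((2 powi (- k)) ^ DIM('a))"
       "emeasure lebesgue (cbox a (a + (2 powi (-k)) *\<^sub>R One)) = ennreal ((2 powi (- k)) ^ DIM('a))"
    by (auto simp: emeasure_lborel_box emeasure_lborel_cbox inner_left_distrib)
  then show ?thesis
    using emeasure_mono[OF a(1), of lebesgue] emeasure_mono[OF a(2), of lebesgue] sets_dyadic_cube[OF assms]
    by (auto intro: antisym)
qed

lemma measure_dyadic_cube:
  fixes Q :: "'a::euclidean_space set"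
  shows "Q \<in> dyadic_cubes k \<Longrightarrow> measure lebesgue Q = (2 powi (- k)) ^ DIM('a)"
  by (simp add: measure_def emeasure_dyadic_cube)

lemma measure_dyadic_cube_pos: "Q \<in> dyadic_cubes k \<Longrightarrow> measure lebesgue Q > 0"
  by (simp add: measure_dyadic_cube)

lemma lmeasurable_dyadic_cube: "Q \<in> dyadic_cubes k \<Longrightarrow> Q \<in> lmeasurable"
  by (rule fmeasurableI) (simp_all only: sets_dyadic_cube emeasure_dyadic_cube ennreal_less_top infinity_ennreal_def)

lemma disjoint_dyadic_cubes: "disjoint (dyadic_cubes k)"
  unfolding disjoint_def using dyadic_cube_at_eqI by blast

lemma Union_dyadic_cubes: "\<Union>(dyadic_cubes k) = UNIV"
  using dyadic_cube_at_in_dyadic_cubes mem_dyadic_cube_at by blast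

section \<open>Integration and measurability along one generation\<close>

lemma nn_integral_Union_disjoint:
  assumes "countable F" "disjoint F" "F \<subseteq> sets M" "f \<in> borel_measurable M"
  shows "(\<integral>\<^sup>+x\<in>\<Union>F. f x \<partial>M) = (\<integral>\<^sup>+Q. (\<integral>\<^sup>+x\<in>Q. f x \<partial>M) \<partial>count_space F)"
proof -
  \<comment> \<open>Splitting the integral is countable additivity of the measure with density
    \<open>f\<close>.\<close>
  have "emeasure (density M f) (\<Union>(id ` F)) = (\<integral>\<^sup>+Q. emeasure (density M f) (id Q) \<partial>count_space F)"
    using assms by (intro emeasure_UN_countable) (auto simp: disjoint_family_on_def disjoint_def)
  moreover have "\<Union>F \<in> sets M" using assms by (auto intro: sets.countable_Union)
  ultimately show ?thesis
    using assms by (auto simp: emeasure_density intro!: nn_integral_cong)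
qed

lemma nn_integral_dyadic_cubes:
  fixes f :: "'a::euclidean_space \<Rightarrow> ennreal"
  assumes "f \<in> borel_measurable lebesgue"
  shows "(\<integral>\<^sup>+x. f x \<partial>lebesgue) = (\<integral>\<^sup>+Q. (\<integral>\<^sup>+x\<in>Q. f x \<partial>lebesgue) \<partial>count_space (dyadic_cubes k))"
proof -
  have "dyadic_cubes k \<subseteq> sets (lebesgue :: 'a measure)"
    using sets_dyadic_cube by blast
  from nn_integral_Union_disjoint[OF countable_dyadic_cubes disjoint_dyadic_cubes this assms]
  show ?thesis by (simp add: Union_dyadic_cubes)
qed

lemma dyadic_E_cong: "y \<in> dyadic_cube_at k x \<Longrightarrow> dyadic_E k g y = dyadic_E k g x"
  unfolding dyadic_E_def by (simp add: dyadic_cube_at_eq_iff[symmetric])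

text \<open>Countably many measurable pieces with a constant value on each. It makes the averages of
  an arbitrary function measurable and later serves for unions of cubes of one generation.\<close>

lemma borel_measurable_dyadic_constant:
  fixes h :: "'a::euclidean_space \<Rightarrow> 'b::topological_space"
  assumes "\<And>x y. y \<in> dyadic_cube_at k x \<Longrightarrow> h y = h x"
  shows "h \<in> borel_measurable lebesgue"
proof (rule measurable_piecewise_restrict[OF countable_dyadic_cubes[of k]])
  show "space lebesgue \<subseteq> \<Union>(dyadic_cubes k :: 'a set set)" by (simp add: Union_dyadic_cubes)
  fix Q :: "'a set" assume Q: "Q \<in> dyadic_cubes k"
  then show "Q \<inter> space lebesgue \<in> sets lebesgue" by (simp add: sets_dyadic_cube)
  obtain x where x: "Q = dyadic_cube_at k x" using Q by (auto simp: dyadic_cubes_eq_range)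
  show "h \<in> measurable (restrict_space lebesgue Q) borel"
    by (subst measurable_cong[where g="\<lambda>_. h x"]) (auto simp: space_restrict_space x intro: assms)
qed

lemma borel_measurable_dyadic_E [measurable]: "dyadic_E k g \<in> borel_measurable lebesgue"
  by (rule borel_measurable_dyadic_constant) (rule dyadic_E_cong)

section \<open>Dyadic averages of square-integrable functions\<close>

lemma L2_space_measurable [measurable_dest]: "f \<in> L2_space \<Longrightarrow> f \<in> borel_measurable lebesgue"
  by (simp add: L2_space_def)

lemma L2_space_integrable: "f \<in> L2_space \<Longrightarrow> integrable lebesgue (\<lambda>x. (cmod (f x))\<^sup>2)"
  by (simp add: L2_space_def)

lemma L2_norm_power2: "(L2_norm f)\<^sup>2 = (LINT x|lebesgue. (cmod (f x))\<^sup>2)"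
  by (simp add: L2_norm_def)

lemma ennreal_L2_norm_power2:
  "f \<in> L2_space \<Longrightarrow> ennreal ((L2_norm f)\<^sup>2) = (\<integral>\<^sup>+x. ennreal ((cmod (f x))\<^sup>2) \<partial>lebesgue)"
  unfolding L2_norm_power2 by (rule nn_integral_eq_integral[symmetric]) (auto simp: L2_space_integrable)

lemma L2_space_iff_nn_integral:
  "f \<in> L2_space \<longleftrightarrow> f \<in> borel_measurable lebesgue \<and> (\<integral>\<^sup>+x. ennreal ((cmod (f x))\<^sup>2) \<partial>lebesgue) < \<infinity>"
  unfolding L2_space_def by (auto simp: integrable_iff_bounded)

lemma cmod_diff_power2_le: "(cmod (a - b))\<^sup>2 \<le> 2 * (cmod a)\<^sup>2 + 2 * (cmod b)\<^sup>2"
proof -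
  have "(cmod (a - b))\<^sup>2 \<le> (cmod a + cmod b)\<^sup>2" by (intro power_mono norm_triangle_ineq4) auto
  then show ?thesis using zero_le_power2[of "cmod a - cmod b"] unfolding power2_sum power2_diff by linarith
qed

text \<open>The crude bound on squares replaces Minkowski's inequality; it suffices because it is
  used only for membership and for convergence to 0.\<close>

lemma L2_space_diff:
  assumes [measurable]: "f \<in> L2_space" "g \<in> L2_space"
  shows "(\<lambda>x. f x - g x) \<in> L2_space"
    and "(L2_norm (\<lambda>x. f x - g x))\<^sup>2 \<le> 2 * (L2_norm f)\<^sup>2 + 2 * (L2_norm g)\<^sup>2"
proof -
  have I: "integrable lebesgue (\<lambda>x. 2 * (cmod (f x))\<^sup>2 + 2 * (cmod (g x))\<^sup>2)"
    using assms by (auto simp: L2_space_integrable)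
  have J: "integrable lebesgue (\<lambda>x. (cmod (f x - g x))\<^sup>2)"
    by (rule Bochner_Integration.integrable_bound[OF I]) (auto simp: cmod_diff_power2_le)
  then show "(\<lambda>x. f x - g x) \<in> L2_space" by (auto simp: L2_space_def)
  have "(LINT x|lebesgue. (cmod (f x - g x))\<^sup>2) \<le> (LINT x|lebesgue. 2 * (cmod (f x))\<^sup>2 + 2 * (cmod (g x))\<^sup>2)"
    by (rule integral_mono[OF J I]) (rule cmod_diff_power2_le)
  then show "(L2_norm (\<lambda>x. f x - g x))\<^sup>2 \<le> 2 * (L2_norm f)\<^sup>2 + 2 * (L2_norm g)\<^sup>2"
    using assms by (simp add: L2_norm_power2 L2_space_integrable)
qed

lemma L2_space_set_integrable:
  assumes "f \<in> L2_space" "A \<in> lmeasurable"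
  shows "set_integrable lebesgue A f" "set_integrable lebesgue A (\<lambda>x. (cmod (f x))\<^sup>2)"
proof -
  have [measurable]: "A \<in> sets lebesgue" "f \<in> borel_measurable lebesgue"
    using assms by (auto simp: fmeasurable_def L2_space_def)
  have I: "integrable lebesgue (\<lambda>x. indicat_real A x + (cmod (f x))\<^sup>2)"
    using assms by (auto simp: L2_space_integrable fmeasurable_def)
  \<comment> \<open>On a set of finite measure this makes an \<open>L^2\<close> function integrable;
    it follows from \<open>(cmod z - 1)\<^sup>2 \<ge> 0\<close>.\<close>
  have "cmod z \<le> 1 + (cmod z)\<^sup>2" for z
    using zero_le_power2[of "cmod z - 1"] norm_ge_zero[of z] unfolding power2_diff one_power2 by linarith
  then show "set_integrable lebesgue A f"
    unfolding set_integrable_def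
    by (intro Bochner_Integration.integrable_bound[OF I]) (auto simp: indicator_def)
  show "set_integrable lebesgue A (\<lambda>x. (cmod (f x))\<^sup>2)"
    unfolding set_integrable_def
    by (intro Bochner_Integration.integrable_bound[OF L2_space_integrable[OF assms(1)]]) (auto simp: indicator_def)
qed

lemma set_nn_integral_eq_set_integral_nonneg:
  assumes "set_integrable M A f" "\<And>x. 0 \<le> f x"
  shows "(\<integral>\<^sup>+x\<in>A. ennreal (f x) \<partial>M) = ennreal (LINT x:A|M. f x)"
proof -
  have "(\<integral>\<^sup>+x\<in>A. ennreal (f x) \<partial>M) = (\<integral>\<^sup>+x. ennreal (indicat_real A x *\<^sub>R f x) \<partial>M)"
    by (rule nn_integral_cong) (auto simp: indicator_def)
  also have "\<dots> = ennreal (LINT x:A|M. f x)"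
    using assms unfolding set_lebesgue_integral_def set_integrable_def
    by (intro nn_integral_eq_integral) auto
  finally show ?thesis .
qed

text \<open>The variance identity: since \<open>c\<close> is the mean of \<open>g\<close> over
  \<open>A\<close>, the cross term \<open>Re (g x * cnj c)\<close> integrates to
  \<open>measure M A * (cmod c)\<^sup>2\<close>.\<close>

lemma average_pythagoras:
  fixes g :: "'a \<Rightarrow> complex"
  assumes A: "A \<in> fmeasurable M" and m: "measure M A > 0"
    and g: "set_integrable M A g" and g2: "set_integrable M A (\<lambda>x. (cmod (g x))\<^sup>2)"
    and c: "c = (LINT x:A|M. g x) / complex_of_real (measure M A)"
  shows "set_integrable M A (\<lambda>x. (cmod (g x - c))\<^sup>2)"
    and "(LINT x:A|M. (cmod (g x))\<^sup>2) = measure M A * (cmod c)\<^sup>2 + (LINT x:A|M. (cmod (g x - c))\<^sup>2)"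
proof -
  have k: "set_integrable M A (\<lambda>_. d)" for d :: "'b::{banach, second_countable_topology}"
    using A by (auto simp: set_integrable_def fmeasurable_def)
  have r: "set_integrable M A (\<lambda>x. Re (g x * cnj c))"
  proof -
    have "integrable M (\<lambda>x. Re ((indicat_real A x *\<^sub>R g x) * cnj c))"
      using g unfolding set_integrable_def by (intro integrable_Re integrable_mult_left) auto
    moreover have "(\<lambda>x. Re ((indicat_real A x *\<^sub>R g x) * cnj c)) = (\<lambda>x. indicat_real A x *\<^sub>R Re (g x * cnj c))"
      by auto
    ultimately show ?thesis unfolding set_integrable_def by simp
  qed
  have eq: "(cmod (g x - c))\<^sup>2 = (cmod (g x))\<^sup>2 - 2 * Re (g x * cnj c) + (cmod c)\<^sup>2" for x
    unfolding cmod_power2 by (simp add: power2_eq_square algebra_simps)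
  show "set_integrable M A (\<lambda>x. (cmod (g x - c))\<^sup>2)"
    unfolding eq by (intro set_integral_add set_integral_diff g2 k set_integrable_mult_right impI r)
  have "(LINT x:A|M. Re (g x * cnj c)) = Re ((LINT x:A|M. g x) * cnj c)"
  proof -
    have "(LINT x:A|M. Re (g x * cnj c)) = (LINT x|M. Re ((indicat_real A x *\<^sub>R g x) * cnj c))"
      unfolding set_lebesgue_integral_def by (rule Bochner_Integration.integral_cong) auto
    also have "\<dots> = Re (LINT x|M. ((indicat_real A x *\<^sub>R g x) * cnj c))"
      using g unfolding set_integrable_def by (intro integral_Re integrable_mult_left) auto
    also have "(LINT x|M. ((indicat_real A x *\<^sub>R g x) * cnj c)) = (LINT x:A|M. g x) * cnj c"
      unfolding set_lebesgue_integral_def by (rule integral_mult_left_zero)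
    finally show ?thesis .
  qed
  also have "\<dots> = measure M A * (cmod c)\<^sup>2"
  proof -
    have "(LINT x:A|M. g x) = complex_of_real (measure M A) * c" using m c by simp
    then show ?thesis unfolding cmod_power2 by (simp add: power2_eq_square algebra_simps)
  qed
  finally have R: "(LINT x:A|M. Re (g x * cnj c)) = measure M A * (cmod c)\<^sup>2" .
  have "(LINT x:A|M. (cmod (g x - c))\<^sup>2) =
      (LINT x:A|M. (cmod (g x))\<^sup>2) - 2 * (LINT x:A|M. Re (g x * cnj c)) + (LINT x:A|M. (cmod c)\<^sup>2)"
  proof -
    have "(LINT x:A|M. u x - 2 * v x + w) = (LINT x:A|M. u x) - 2 * (LINT x:A|M. v x) + (LINT x:A|M. w)"
      if "set_integrable M A u" "set_integrable M A v" for u v :: "'a \<Rightarrow> real" and w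
      using that k[of w] by (simp add: set_integral_add set_integral_diff)
    then show ?thesis unfolding eq using g2 r by blast
  qed
  also have "(LINT x:A|M. (cmod c)\<^sup>2) = measure M A * (cmod c)\<^sup>2"
    using A by (simp add: set_lebesgue_integral_def fmeasurable_def)
  finally show "(LINT x:A|M. (cmod (g x))\<^sup>2) = measure M A * (cmod c)\<^sup>2 + (LINT x:A|M. (cmod (g x - c))\<^sup>2)"
    using R by simp
qed

lemma dyadic_E_on_cube:
  assumes "Q \<in> dyadic_cubes k" "x \<in> Q"
  shows "dyadic_E k g x = (LINT y:Q|lebesgue. g y) / complex_of_real (measure lebesgue Q)"
  using dyadic_cube_at_eqI[OF assms] by (simp add: dyadic_E_def)

text \<open>The variance identity moved to \<open>ennreal\<close>, so that it can be added over all
  cubes of a generation.\<close>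

lemma dyadic_E_pythagoras_cube:
  fixes g :: "'a::euclidean_space \<Rightarrow> complex"
  assumes g: "g \<in> L2_space" and Q: "Q \<in> dyadic_cubes k"
  shows "(\<integral>\<^sup>+x\<in>Q. ennreal ((cmod (g x))\<^sup>2) \<partial>lebesgue) =
     (\<integral>\<^sup>+x\<in>Q. ennreal ((cmod (dyadic_E k g x))\<^sup>2) \<partial>lebesgue) +
     (\<integral>\<^sup>+x\<in>Q. ennreal ((cmod (g x - dyadic_E k g x))\<^sup>2) \<partial>lebesgue)"
proof -
  define c where "c = (LINT y:Q|lebesgue. g y) / complex_of_real (measure lebesgue Q)"
  have k: "set_integrable lebesgue Q (\<lambda>_. (cmod c)\<^sup>2)"
    using lmeasurable_dyadic_cube[OF Q] by (auto simp: set_integrable_def fmeasurable_def)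
  have E: "dyadic_E k g x = c" if "x \<in> Q" for x
    using dyadic_E_on_cube[OF Q that] by (simp add: c_def)
  note p = average_pythagoras[OF lmeasurable_dyadic_cube[OF Q] measure_dyadic_cube_pos[OF Q]
      L2_space_set_integrable[OF g lmeasurable_dyadic_cube[OF Q]] c_def]
  have "(\<integral>\<^sup>+x\<in>Q. ennreal ((cmod (dyadic_E k g x))\<^sup>2) \<partial>lebesgue) = (\<integral>\<^sup>+x\<in>Q. ennreal ((cmod c)\<^sup>2) \<partial>lebesgue)"
    by (rule nn_integral_cong) (auto simp: E indicator_def)
  also have "\<dots> = ennreal (measure lebesgue Q * (cmod c)\<^sup>2)"
    using lmeasurable_dyadic_cube[OF Q]
    by (subst set_nn_integral_eq_set_integral_nonneg[OF k]) (auto simp: set_lebesgue_integral_def fmeasurable_def)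
  finally have 1: "(\<integral>\<^sup>+x\<in>Q. ennreal ((cmod (dyadic_E k g x))\<^sup>2) \<partial>lebesgue) = ennreal (measure lebesgue Q * (cmod c)\<^sup>2)" .
  have "(\<integral>\<^sup>+x\<in>Q. ennreal ((cmod (g x - dyadic_E k g x))\<^sup>2) \<partial>lebesgue) = (\<integral>\<^sup>+x\<in>Q. ennreal ((cmod (g x - c))\<^sup>2) \<partial>lebesgue)"
    by (rule nn_integral_cong) (auto simp: E indicator_def)
  also have "\<dots> = ennreal (LINT x:Q|lebesgue. (cmod (g x - c))\<^sup>2)"
    by (rule set_nn_integral_eq_set_integral_nonneg[OF p(1)]) auto
  finally have 2: "(\<integral>\<^sup>+x\<in>Q. ennreal ((cmod (g x - dyadic_E k g x))\<^sup>2) \<partial>lebesgue) = ennreal (LINT x:Q|lebesgue. (cmod (g x - c))\<^sup>2)" .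
  have "(\<integral>\<^sup>+x\<in>Q. ennreal ((cmod (g x))\<^sup>2) \<partial>lebesgue) = ennreal (LINT x:Q|lebesgue. (cmod (g x))\<^sup>2)"
    by (rule set_nn_integral_eq_set_integral_nonneg[OF L2_space_set_integrable(2)[OF g lmeasurable_dyadic_cube[OF Q]]]) auto
  then show ?thesis
    unfolding 1 2 p(2)
    by (simp add: ennreal_plus set_lebesgue_integral_def)
qed

lemma dyadic_E_L2:
  fixes g :: "'a::euclidean_space \<Rightarrow> complex"
  assumes g[measurable]: "g \<in> L2_space"
  shows dyadic_E_in_L2_space: "dyadic_E k g \<in> L2_space"
    and dyadic_E_pythagoras:
      "(L2_norm g)\<^sup>2 = (L2_norm (dyadic_E k g))\<^sup>2 + (L2_norm (\<lambda>x. g x - dyadic_E k g x))\<^sup>2"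
proof -
  let ?N = "\<lambda>h :: 'a \<Rightarrow> complex. \<integral>\<^sup>+x. ennreal ((cmod (h x))\<^sup>2) \<partial>lebesgue"
  have *: "?N g = ?N (dyadic_E k g) + ?N (\<lambda>x. g x - dyadic_E k g x)"
    by (subst (1 2 3) nn_integral_dyadic_cubes[where k=k], measurable)
      (auto simp: dyadic_E_pythagoras_cube[OF g] simp flip: nn_integral_add intro!: nn_integral_cong)
  \<comment> \<open>Finiteness of the left side passes to both summands on the right; this is how
    \<open>dyadic_E k g\<close> is seen to be square-integrable.\<close>
  have "?N g < \<infinity>" using g by (simp add: L2_space_iff_nn_integral)
  with * show 1: "dyadic_E k g \<in> L2_space" by (auto simp: L2_space_iff_nn_integral)
  have "ennreal ((L2_norm g)\<^sup>2) = ennreal ((L2_norm (dyadic_E k g))\<^sup>2 + (L2_norm (\<lambda>x. g x - dyadic_E k g x))\<^sup>2)"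
    using * by (simp add: ennreal_L2_norm_power2[OF g] ennreal_L2_norm_power2[OF 1]
        ennreal_L2_norm_power2[OF L2_space_diff(1)[OF g 1]])
  then show "(L2_norm g)\<^sup>2 = (L2_norm (dyadic_E k g))\<^sup>2 + (L2_norm (\<lambda>x. g x - dyadic_E k g x))\<^sup>2"
    by (subst (asm) ennreal_inj) auto
qed

text \<open>Cauchy-Schwarz on one cube, obtained by dropping the nonnegative variance term of
  \<open>average_pythagoras\<close>. The denominator is the volume of the cube, which forces decay
  as \<open>k\<close> decreases.\<close>

lemma dyadic_E_bound:
  fixes g :: "'a::euclidean_space \<Rightarrow> complex"
  assumes g: "g \<in> L2_space"
  shows "(cmod (dyadic_E k g x))\<^sup>2 \<le> (L2_norm g)\<^sup>2 / (2 powi (- k)) ^ DIM('a)"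
proof -
  let ?Q = "dyadic_cube_at k x"
  note Q = dyadic_cube_at_in_dyadic_cubes[of k x]
  note p = average_pythagoras[OF lmeasurable_dyadic_cube[OF Q] measure_dyadic_cube_pos[OF Q]
      L2_space_set_integrable[OF g lmeasurable_dyadic_cube[OF Q]] dyadic_E_on_cube[OF Q mem_dyadic_cube_at]]
  have "measure lebesgue ?Q * (cmod (dyadic_E k g x))\<^sup>2 \<le> (LINT y:?Q|lebesgue. (cmod (g y))\<^sup>2)"
    unfolding p(2) by (simp add: set_lebesgue_integral_def)
  also have "\<dots> \<le> (L2_norm g)\<^sup>2"
    unfolding L2_norm_power2 set_lebesgue_integral_def
    using L2_space_set_integrable(2)[OF g lmeasurable_dyadic_cube[OF Q]]
    by (intro integral_mono L2_space_integrable[OF g]) (auto simp: set_integrable_def indicator_def)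
  finally show ?thesis
    by (simp add: measure_dyadic_cube[OF Q] field_simps)
qed

text \<open>\<open>dyadic_E k g\<close> and \<open>g\<close> have equal integrals over each cube of
  generation \<open>k\<close>, and by nesting those cubes tile the larger cube of generation
  \<open>j\<close>.\<close>

lemma dyadic_E_tower:
  fixes g :: "'a::euclidean_space \<Rightarrow> complex"
  assumes g: "g \<in> L2_space" and "j \<le> k"
  shows "dyadic_E j (dyadic_E k g) x = dyadic_E j g x"
proof -
  let ?Q = "dyadic_cube_at j x"
  define F where "F = {R \<in> dyadic_cubes k. R \<subseteq> ?Q}"
  have F: "?Q = \<Union>F"
  proof -
    have "dyadic_cube_at k y \<in> F \<and> y \<in> dyadic_cube_at k y" if "y \<in> ?Q" for y
      using dyadic_cube_at_nested[OF \<open>j \<le> k\<close>, of y] that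
      by (auto simp: F_def dyadic_cube_at_in_dyadic_cubes simp flip: dyadic_cube_at_eq_iff)
    then show ?thesis by (fastforce simp: F_def)
  qed
  have cF: "countable F" unfolding F_def by (rule countable_subset[OF _ countable_dyadic_cubes[of k]]) auto
  have "F \<noteq> {}" using F mem_dyadic_cube_at by fastforce
  have eq: "(LINT y:R|lebesgue. dyadic_E k g y) = (LINT y:R|lebesgue. g y)" if R: "R \<in> dyadic_cubes k" for R
  proof -
    have "(LINT y:R|lebesgue. dyadic_E k g y) =
       (LINT y:R|lebesgue. (LINT y:R|lebesgue. g y) / complex_of_real (measure lebesgue R))"
      by (rule set_lebesgue_integral_cong) (auto simp: sets_dyadic_cube[OF R] dyadic_E_on_cube[OF R])
    also have "\<dots> = (LINT y:R|lebesgue. g y)"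
      using lmeasurable_dyadic_cube[OF R] measure_dyadic_cube_pos[OF R]
      by (simp add: set_lebesgue_integral_def fmeasurable_def scaleR_conv_of_real)
    finally show ?thesis .
  qed
  \<comment> \<open>Countable additivity of the Bochner integral asks for a disjoint sequence.
    \<open>from_nat_into F\<close> may list a cube repeatedly; \<open>disjointed\<close> keeps its
    first occurrence whole and turns every later one into the empty set.\<close>
  have sum: "set_lebesgue_integral lebesgue ?Q h = (\<Sum>n. set_lebesgue_integral lebesgue (disjointed (from_nat_into F) n) h)"
    if h: "set_integrable lebesgue ?Q h" for h :: "'a \<Rightarrow> complex"
  proof -
    have U: "(\<Union>n. disjointed (from_nat_into F) n) = ?Q"
      using \<open>F \<noteq> {}\<close> cF by (simp add: UN_disjointed_eq range_from_nat_into F)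
    have "from_nat_into F n \<in> sets lebesgue" for n
      using from_nat_into[OF \<open>F \<noteq> {}\<close>, of n] by (auto simp: F_def sets_dyadic_cube)
    then have "disjointed (from_nat_into F) n \<in> sets lebesgue" for n
      by (metis image_subsetI sets.range_disjointed_sets range_subsetD)
    with lebesgue_integral_countable_add[of "disjointed (from_nat_into F)" lebesgue h] h
    show ?thesis using disjoint_family_disjointed[of "from_nat_into F"]
      by (auto simp: U disjoint_family_on_def)
  qed
  have dis: "disjointed (from_nat_into F) n = {} \<or> disjointed (from_nat_into F) n \<in> dyadic_cubes k" for n
  proof (cases "from_nat_into F n \<in> from_nat_into F ` {0..<n}")
    case False
    have in_k: "from_nat_into F i \<in> dyadic_cubes k" for i
      using from_nat_into[OF \<open>F \<noteq> {}\<close>, of i] by (auto simp: F_def)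
    have "from_nat_into F i \<inter> from_nat_into F n = {}" if "i < n" for i
    proof -
      have "from_nat_into F i \<noteq> from_nat_into F n" using False that by (metis atLeast0LessThan imageI lessThan_iff)
      then show ?thesis using disjoint_dyadic_cubes[of k] in_k by (auto simp: disjoint_def)
    qed
    then have "disjointed (from_nat_into F) n = from_nat_into F n"
      unfolding disjointed_def by fastforce
    then show ?thesis using in_k by simp
  qed (auto simp: disjointed_def)
  have "(LINT y:?Q|lebesgue. dyadic_E k g y) = (LINT y:?Q|lebesgue. g y)"
  proof -
    have "set_integrable lebesgue ?Q (dyadic_E k g)" "set_integrable lebesgue ?Q g"
      using L2_space_set_integrable(1) dyadic_E_in_L2_space[OF g] g
        lmeasurable_dyadic_cube[OF dyadic_cube_at_in_dyadic_cubes] by blast+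
    moreover have "set_lebesgue_integral lebesgue (disjointed (from_nat_into F) n) (dyadic_E k g) =
        set_lebesgue_integral lebesgue (disjointed (from_nat_into F) n) g" for n
      using dis[of n] eq by (auto simp: set_lebesgue_integral_def)
    ultimately show ?thesis by (simp add: sum)
  qed
  then show ?thesis by (simp add: dyadic_E_def)
qed

text \<open>With \<open>j = k - 1\<close> it expresses the squared norm of a martingale difference
  as a difference of squared norms, so that their sum telescopes.\<close>

lemma dyadic_E_martingale_pythagoras:
  fixes g :: "'a::euclidean_space \<Rightarrow> complex"
  assumes g: "g \<in> L2_space" and "j \<le> k"
  shows "(L2_norm (dyadic_E k g))\<^sup>2 =
    (L2_norm (dyadic_E j g))\<^sup>2 + (L2_norm (\<lambda>x. dyadic_E k g x - dyadic_E j g x))\<^sup>2"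
proof -
  have "dyadic_E j (dyadic_E k g) = dyadic_E j g" using dyadic_E_tower[OF assms] by blast
  then show ?thesis using dyadic_E_pythagoras[OF dyadic_E_in_L2_space[OF g, of k], of j] by simp
qed

section \<open>Dyadic Lebesgue differentiation\<close>

lemma dyadic_E_cmult: "dyadic_E k (\<lambda>x. c * g x) x = c * dyadic_E k g x"
  by (simp add: dyadic_E_def)

lemma
  fixes f g :: "'a::euclidean_space \<Rightarrow> complex"
  assumes "integrable lebesgue f" "integrable lebesgue g"
  shows dyadic_E_add: "dyadic_E k (\<lambda>x. f x + g x) x = dyadic_E k f x + dyadic_E k g x"
    and dyadic_E_diff: "dyadic_E k (\<lambda>x. f x - g x) x = dyadic_E k f x - dyadic_E k g x"
proof -
  have "set_integrable lebesgue (dyadic_cube_at k x) h" if "integrable lebesgue h" for h :: "'a \<Rightarrow> complex"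
    unfolding set_integrable_def using that
    by (intro integrable_mult_indicator sets_dyadic_cube[OF dyadic_cube_at_in_dyadic_cubes])
  note I = this[OF assms(1)] this[OF assms(2)]
  show "dyadic_E k (\<lambda>x. f x + g x) x = dyadic_E k f x + dyadic_E k g x"
    unfolding dyadic_E_def set_integral_add(2)[OF I] by (rule add_divide_distrib)
  show "dyadic_E k (\<lambda>x. f x - g x) x = dyadic_E k f x - dyadic_E k g x"
    unfolding dyadic_E_def set_integral_diff(2)[OF I] by (rule diff_divide_distrib)
qed

lemma dyadic_E_constant_on_cube:
  assumes "\<And>y. y \<in> dyadic_cube_at k x \<Longrightarrow> h y = h x"
  shows "dyadic_E k h x = h x"
proof -
  let ?Q = "dyadic_cube_at k x"
  note Q = dyadic_cube_at_in_dyadic_cubes[of k x]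
  have "(LINT y:?Q|lebesgue. h y) = (LINT y:?Q|lebesgue. h x)"
    by (rule set_lebesgue_integral_cong) (use sets_dyadic_cube[OF Q] assms in blast)+
  then show ?thesis
    using lmeasurable_dyadic_cube[OF Q] measure_dyadic_cube_pos[OF Q]
    by (simp add: dyadic_E_def set_lebesgue_integral_def fmeasurable_def scaleR_conv_of_real)
qed

section \<open>Weak-type bound for the dyadic maximal function\<close>

lemma dyadic_cube_large_average:
  fixes g :: "'a::euclidean_space \<Rightarrow> complex"
  assumes g: "integrable lebesgue g" and Q: "Q \<in> dyadic_cubes k" and x: "x \<in> Q"
    and l: "l < cmod (dyadic_E k g x)"
  shows "(\<integral>\<^sup>+x\<in>Q. ennreal l \<partial>lebesgue) \<le> (\<integral>\<^sup>+x\<in>Q. ennreal (cmod (g x)) \<partial>lebesgue)"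
proof -
  note m = measure_dyadic_cube_pos[OF Q]
  have gQ: "set_integrable lebesgue Q g"
    unfolding set_integrable_def by (rule integrable_mult_indicator[OF sets_dyadic_cube[OF Q] g])
  have "l * measure lebesgue Q \<le> cmod (LINT y:Q|lebesgue. g y)"
    using l m unfolding dyadic_E_on_cube[OF Q x] norm_divide by (simp add: field_simps)
  also have "\<dots> \<le> (LINT y:Q|lebesgue. cmod (g y))"
    by (rule set_integral_norm_bound[OF gQ])
  finally have *: "l * measure lebesgue Q \<le> (LINT y:Q|lebesgue. cmod (g y))" .
  \<comment> \<open>Keeping \<open>ennreal l\<close> inside an integral lets
    \<open>nn_integral_Union_disjoint\<close> add both sides over cubes. A negative \<open>l\<close>
    is sent to 0 by \<open>ennreal\<close>.\<close>
  have "(\<integral>\<^sup>+x\<in>Q. ennreal l \<partial>lebesgue) = ennreal l * ennreal (measure lebesgue Q)"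
    using sets_dyadic_cube[OF Q] lmeasurable_dyadic_cube[OF Q]
    by (simp add: nn_integral_cmult_indicator emeasure_eq_measure2 del: sets_completionI_sets)
  also have "\<dots> = ennreal (l * measure lebesgue Q)"
    by (simp add: ennreal_mult'')
  also have "\<dots> \<le> ennreal (LINT y:Q|lebesgue. cmod (g y))" by (rule ennreal_leI[OF *])
  also have "\<dots> = (\<integral>\<^sup>+x\<in>Q. ennreal (cmod (g x)) \<partial>lebesgue)"
    by (rule set_nn_integral_eq_set_integral_nonneg[symmetric]) (auto intro: set_integrable_norm gQ)
  finally show ?thesis .
qed

text \<open>The cubes of the first generation at which the average exceeds \<open>l\<close> are disjoint and cover the set.\<close>

lemma dyadic_maximal_weak_type:
  fixes g :: "'a::euclidean_space \<Rightarrow> complex" and l :: real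
  assumes g: "integrable lebesgue g"
  defines "B \<equiv> {x. \<exists>k::nat. l < cmod (dyadic_E (int k) g x)}"
  shows "B \<in> sets lebesgue"
    and "ennreal l * emeasure lebesgue B \<le> (\<integral>\<^sup>+x. ennreal (cmod (g x)) \<partial>lebesgue)"
proof -
  have "{x \<in> space lebesgue. \<exists>k::nat. l < cmod (dyadic_E (int k) g x)} \<in> sets lebesgue" by measurable
  then show B: "B \<in> sets lebesgue" by (simp add: B_def)
  \<comment> \<open>A stopping time: the first generation from 0 on at which the average exceeds
    \<open>l\<close>. It exists for every point of \<open>B\<close>.\<close>
  define K where "K x = (LEAST k::nat. l < cmod (dyadic_E (int k) g x))" for x
  define F where "F = (\<lambda>x. dyadic_cube_at (int (K x)) x) ` B"
  have K: "l < cmod (dyadic_E (int (K x)) g x)" if "x \<in> B" for x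
    using that unfolding B_def K_def by (auto intro: LeastI)
  have same: "dyadic_E (int j) g z = dyadic_E (int j) g x" if "z \<in> dyadic_cube_at (int (K x)) x" "j \<le> K x" for x z j
    using dyadic_cube_at_nested[of "int j" "int (K x)" x] that by (intro dyadic_E_cong) auto
  have sub: "dyadic_cube_at (int (K x)) x \<subseteq> B" if "x \<in> B" for x
  proof
    fix z assume "z \<in> dyadic_cube_at (int (K x)) x"
    then have "l < cmod (dyadic_E (int (K x)) g z)" using same[of z x "K x"] K[OF that] by simp
    then show "z \<in> B" unfolding B_def by blast
  qed
  \<comment> \<open>The stopping time is constant on a stopping cube: by nesting, \<open>z\<close>
    and \<open>x\<close> have the same averages in all generations up to \<open>K x\<close>.\<close>
  have Keq: "K z = K x" if "x \<in> B" "z \<in> dyadic_cube_at (int (K x)) x" for x z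
    unfolding K_def[of z]
  proof (rule Least_equality)
    show "l < cmod (dyadic_E (int (K x)) g z)" using K[OF that(1)] same[OF that(2)] by simp
    fix j assume j: "l < cmod (dyadic_E (int j) g z)"
    show "K x \<le> j"
    proof (rule ccontr)
      assume "\<not> K x \<le> j"
      then have "l < cmod (dyadic_E (int j) g x)" "j < K x" using j same[OF that(2), of j] by auto
      then show False unfolding K_def by (auto dest: not_less_Least)
    qed
  qed
  have UF: "\<Union>F = B" using sub by (auto simp: F_def)
  have "countable (\<Union>k::nat. dyadic_cubes (int k) :: 'a set set)"
    by (intro countable_UN countable_dyadic_cubes) auto
  then have cF: "countable F"
    by (rule countable_subset[rotated]) (use dyadic_cube_at_in_dyadic_cubes in \<open>fastforce simp: F_def\<close>)
  \<comment> \<open>Two stopping cubes with a common point \<open>z\<close> both equal the stopping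
    cube of \<open>z\<close>.\<close>
  have dF: "disjoint F"
  proof (rule disjointI)
    fix P Q assume PQ: "P \<in> F" "Q \<in> F" "P \<noteq> Q"
    from PQ obtain x y where x: "x \<in> B" "P = dyadic_cube_at (int (K x)) x"
      and y: "y \<in> B" "Q = dyadic_cube_at (int (K y)) y" by (auto simp: F_def)
    show "P \<inter> Q = {}"
    proof (rule ccontr)
      assume "P \<inter> Q \<noteq> {}"
      then obtain z where "z \<in> P" "z \<in> Q" by auto
      then have "P = dyadic_cube_at (int (K z)) z" "Q = dyadic_cube_at (int (K z)) z"
        using Keq[OF x(1), of z] Keq[OF y(1), of z] x(2) y(2)
        by (auto simp: dyadic_cube_at_eq_iff[symmetric])
      then show False using PQ by simp
    qed
  qed
  have mF: "F \<subseteq> sets lebesgue" by (auto simp: F_def sets_dyadic_cube[OF dyadic_cube_at_in_dyadic_cubes])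
  have [measurable]: "g \<in> borel_measurable lebesgue" using g by auto
  have "ennreal l * emeasure lebesgue B = (\<integral>\<^sup>+x\<in>\<Union>F. ennreal l \<partial>lebesgue)"
    unfolding UF using B by (simp add: nn_integral_cmult_indicator)
  also have "\<dots> = (\<integral>\<^sup>+Q. (\<integral>\<^sup>+x\<in>Q. ennreal l \<partial>lebesgue) \<partial>count_space F)"
    by (rule nn_integral_Union_disjoint[OF cF dF mF]) auto
  also have "\<dots> \<le> (\<integral>\<^sup>+Q. (\<integral>\<^sup>+x\<in>Q. ennreal (cmod (g x)) \<partial>lebesgue) \<partial>count_space F)"
  proof (rule nn_integral_mono)
    fix Q assume "Q \<in> space (count_space F)"
    then obtain x where x: "x \<in> B" "Q = dyadic_cube_at (int (K x)) x" by (auto simp: F_def)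
    show "(\<integral>\<^sup>+x\<in>Q. ennreal l \<partial>lebesgue) \<le> (\<integral>\<^sup>+x\<in>Q. ennreal (cmod (g x)) \<partial>lebesgue)"
      by (rule dyadic_cube_large_average[OF g _ _ K[OF x(1)]]) (auto simp: x dyadic_cube_at_in_dyadic_cubes)
  qed
  also have "\<dots> = (\<integral>\<^sup>+x\<in>\<Union>F. ennreal (cmod (g x)) \<partial>lebesgue)"
    by (rule nn_integral_Union_disjoint[OF cF dF mF, symmetric]) measurable
  also have "\<dots> \<le> (\<integral>\<^sup>+x. ennreal (cmod (g x)) \<partial>lebesgue)"
    by (rule nn_integral_mono) (auto simp: indicator_def)
  finally show "ennreal l * emeasure lebesgue B \<le> (\<integral>\<^sup>+x. ennreal (cmod (g x)) \<partial>lebesgue)" .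
qed

text \<open>
  By the weak-type bound these functions are closed under limits in \<open>L\<^sup>1\<close>. They contain the indicators of
  unions of dyadic cubes of one generation, hence those of open sets and, by outer regularity, those of
  measurable sets of finite measure.
\<close>

definition dyadic_differentiable :: "('a::euclidean_space \<Rightarrow> complex) \<Rightarrow> bool" where
  "dyadic_differentiable g \<longleftrightarrow> integrable lebesgue g \<and>
     (AE x in lebesgue. (\<lambda>k::nat. dyadic_E (int k) g x) \<longlonglongrightarrow> g x)"

text \<open>At level \<open>l\<close>, the index \<open>n\<close> fails at x if either the maximal
  function of \<open>g - p n\<close> or \<open>cmod (g x - p n x)\<close> exceeds \<open>l\<close>.
  The weak-type bound and Chebyshev's inequality control the two sets by the \<open>L^1\<close>
  distance divided by \<open>l\<close>.\<close>

lemma dyadic_differentiable_L1_limit: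
  fixes g :: "'a::euclidean_space \<Rightarrow> complex"
  assumes g: "integrable lebesgue g" and p: "\<And>n::nat. dyadic_differentiable (p n)"
    and lim: "(\<lambda>n. \<integral>\<^sup>+x. ennreal (cmod (g x - p n x)) \<partial>lebesgue) \<longlonglongrightarrow> 0"
  shows "dyadic_differentiable g"
proof -
  have pint: "integrable lebesgue (p n)" for n using p by (simp add: dyadic_differentiable_def)
  have [measurable]: "g \<in> borel_measurable lebesgue" "p n \<in> borel_measurable lebesgue" for n
    using g pint by auto
  define I where "I n = (\<integral>\<^sup>+x. ennreal (cmod (g x - p n x)) \<partial>lebesgue)" for n
  define B1 where "B1 l n = {x. \<exists>k::nat. l < cmod (dyadic_E (int k) (\<lambda>x. g x - p n x) x)}" for l n
  define B2 where "B2 l n = {x. l < cmod (g x - p n x)}" for l n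
  have dint: "integrable lebesgue (\<lambda>x. g x - p n x)" for n using g pint by auto
  have B1: "B1 l n \<in> sets lebesgue" "ennreal l * emeasure lebesgue (B1 l n) \<le> I n" for l n
    unfolding B1_def I_def by (rule dyadic_maximal_weak_type[OF dint])+
  have B2: "B2 l n \<in> sets lebesgue" for l n
  proof -
    have "{x \<in> space lebesgue. l < cmod (g x - p n x)} \<in> sets lebesgue" by measurable
    then show ?thesis by (simp add: B2_def)
  qed
  have B2': "ennreal l * emeasure lebesgue (B2 l n) \<le> I n" for l n
  proof -
    have "ennreal l * emeasure lebesgue (B2 l n) = (\<integral>\<^sup>+x\<in>B2 l n. ennreal l \<partial>lebesgue)"
      using B2 by (simp add: nn_integral_cmult_indicator)
    also have "\<dots> \<le> I n" unfolding I_def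
      by (rule nn_integral_mono) (auto simp: indicator_def B2_def intro: ennreal_leI)
    finally show ?thesis .
  qed
  \<comment> \<open>The exceptional sets need not decrease in \<open>n\<close>. Their intersection
    is null because it is smaller than each of them, and a point outside it has one good
    \<open>n\<close>, which is all that the estimate below uses.\<close>
  define N where "N l = (\<Inter>n. B1 l n \<union> B2 l n)" for l
  have N: "N l \<in> null_sets lebesgue" if "l > 0" for l
  proof -
    have m: "N l \<in> sets lebesgue" unfolding N_def using B1 B2 by auto
    have "ennreal l * emeasure lebesgue (N l) \<le> I n + I n" for n
    proof -
      have "emeasure lebesgue (N l) \<le> emeasure lebesgue (B1 l n \<union> B2 l n)"
        using B1 B2 by (intro emeasure_mono) (auto simp: N_def)
      also have "\<dots> \<le> emeasure lebesgue (B1 l n) + emeasure lebesgue (B2 l n)"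
        using B1 B2 by (intro emeasure_subadditive) auto
      finally have "ennreal l * emeasure lebesgue (N l) \<le> ennreal l * (emeasure lebesgue (B1 l n) + emeasure lebesgue (B2 l n))"
        by (rule mult_left_mono) simp
      also have "\<dots> \<le> I n + I n" unfolding distrib_left using B1 B2' by (intro add_mono)
      finally show ?thesis .
    qed
    moreover have "(\<lambda>n. I n + I n) \<longlonglongrightarrow> 0" using tendsto_add[OF lim lim] by (simp add: I_def)
    ultimately have "ennreal l * emeasure lebesgue (N l) \<le> 0"
      by (intro LIMSEQ_le_const) auto
    then have "emeasure lebesgue (N l) = 0" using that by auto
    then show ?thesis using m by (auto intro: null_setsI)
  qed
  have "AE x in lebesgue. \<forall>j::nat. x \<notin> N (1 / real (Suc j))"
    unfolding AE_all_countable by (intro allI AE_not_in N) auto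
  moreover have "AE x in lebesgue. \<forall>n. (\<lambda>k::nat. dyadic_E (int k) (p n) x) \<longlonglongrightarrow> p n x"
    unfolding AE_all_countable using p by (simp add: dyadic_differentiable_def)
  ultimately have "AE x in lebesgue. (\<lambda>k::nat. dyadic_E (int k) g x) \<longlonglongrightarrow> g x"
  proof eventually_elim
    case (elim x)
    show ?case
    proof (rule LIMSEQ_I)
      fix e :: real assume "e > 0"
      \<comment> \<open>One third for each term: the average of \<open>g - p n\<close>, the
        convergence for \<open>p n\<close>, and the pointwise distance of \<open>g\<close> from
        \<open>p n\<close>.\<close>
      then obtain j where j: "1 / real (Suc j) < e / 3"
        using reals_Archimedean[of "e / 3"] by (auto simp: inverse_eq_divide)
      let ?l = "1 / real (Suc j)"
      obtain n where n: "x \<notin> B1 ?l n" "x \<notin> B2 ?l n" using elim(1) unfolding N_def by blast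
      obtain k0 where k0: "\<And>k. k \<ge> k0 \<Longrightarrow> cmod (dyadic_E (int k) (p n) x - p n x) < ?l"
        using LIMSEQ_D[OF elim(2)[rule_format, of n], of ?l] by auto
      have "cmod (dyadic_E (int k) g x - g x) < e" if "k \<ge> k0" for k
      proof -
        have "cmod (dyadic_E (int k) g x - dyadic_E (int k) (p n) x) \<le> ?l"
          using n(1) unfolding B1_def dyadic_E_diff[OF g pint] by (auto simp: not_less)
        moreover have "cmod (g x - p n x) \<le> ?l" using n(2) unfolding B2_def by (auto simp: not_less)
        moreover have "dyadic_E (int k) g x - g x = (dyadic_E (int k) g x - dyadic_E (int k) (p n) x)
           + (dyadic_E (int k) (p n) x - p n x) - (g x - p n x)" by simp
        then have "cmod (dyadic_E (int k) g x - g x) \<le> cmod (dyadic_E (int k) g x - dyadic_E (int k) (p n) x)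
           + cmod (dyadic_E (int k) (p n) x - p n x) + cmod (g x - p n x)"
          by (metis (no_types, lifting) add_right_mono norm_triangle_ineq norm_triangle_ineq4 order_trans)
        ultimately show ?thesis using k0[OF that] j by linarith
      qed
      then show "\<exists>no. \<forall>k\<ge>no. norm (dyadic_E (int k) g x - g x) < e" by auto
    qed
  qed
  with g show ?thesis by (simp add: dyadic_differentiable_def)
qed

section \<open>Differentiation of indicators and of integrable functions\<close>

lemma nn_integral_cmod_indicator_diff:
  assumes "A \<subseteq> U" "U - A \<in> sets M"
  shows "(\<integral>\<^sup>+x. ennreal (cmod (indicator U x - indicator A x)) \<partial>M) = emeasure M (U - A)"
    "(\<integral>\<^sup>+x. ennreal (cmod (indicator A x - indicator U x)) \<partial>M) = emeasure M (U - A)"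
proof -
  have "ennreal (cmod (indicator U x - indicator A x)) = indicator (U - A) x"
    "ennreal (cmod (indicator A x - indicator U x)) = indicator (U - A) x" for x
    using assms by (auto simp: indicator_def)
  then show "(\<integral>\<^sup>+x. ennreal (cmod (indicator U x - indicator A x)) \<partial>M) = emeasure M (U - A)"
    "(\<integral>\<^sup>+x. ennreal (cmod (indicator A x - indicator U x)) \<partial>M) = emeasure M (U - A)"
    using assms by simp_all
qed

lemma dyadic_cube_at_eventually_subset_open:
  fixes x :: "'a::euclidean_space"
  assumes "open U" "x \<in> U"
  shows "\<exists>m::nat. dyadic_cube_at (int m) x \<subseteq> U"
proof -
  obtain e where e: "e > 0" "ball x e \<subseteq> U" using assms openE by blast
  \<comment> \<open>Points of one cube differ by less than \<open>1 / 2 ^ m\<close> in each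
    coordinate, hence by less than \<open>DIM('a) / 2 ^ m\<close> in norm, through the sum of the
    coordinate distances.\<close>
  obtain m :: nat where m: "real DIM('a) / e < 2 ^ m"
    using real_arch_pow[of 2 "real DIM('a) / e"] by auto
  have "y \<in> ball x e" if y: "y \<in> dyadic_cube_at (int m) x" for y
  proof -
    have "\<bar>(x - y) \<bullet> b\<bar> < 1 / 2 ^ m" if "b \<in> Basis" for b
    proof -
      have "\<lfloor>(y \<bullet> b) * 2 ^ m\<rfloor> = \<lfloor>(x \<bullet> b) * 2 ^ m\<rfloor>"
        using y that by (simp add: dyadic_cube_at_altdef)
      then have "\<bar>(x \<bullet> b) * 2 ^ m - (y \<bullet> b) * 2 ^ m\<bar> < 1" by linarith
      then have "\<bar>x \<bullet> b - y \<bullet> b\<bar> * 2 ^ m < 1"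
        by (simp add: abs_mult flip: left_diff_distrib)
      then show ?thesis by (simp add: inner_diff_left field_simps)
    qed
    then have "(\<Sum>b\<in>Basis. \<bar>(x - y) \<bullet> b\<bar>) < (\<Sum>b\<in>(Basis::'a set). 1 / 2 ^ m)"
      by (intro sum_strict_mono) auto
    then have "norm (x - y) < real DIM('a) / 2 ^ m" using norm_le_l1[of "x - y"] by simp
    also have "\<dots> < e" using m e by (simp add: field_simps)
    finally show ?thesis by (simp add: dist_norm)
  qed
  then show ?thesis using e by blast
qed

lemma integrable_complex_indicator:
  assumes "A \<in> sets M" "emeasure M A < \<infinity>"
  shows "integrable M (indicator A :: 'a \<Rightarrow> complex)"
proof -
  have "integrable M (\<lambda>x. complex_of_real (indicat_real A x))"
    by (rule integrable_of_real[OF integrable_real_indicator[OF assms]])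
  moreover have "(\<lambda>x. complex_of_real (indicat_real A x)) = indicator A"
    by (auto simp: indicator_def)
  ultimately show ?thesis by simp
qed

text \<open>\<open>V m\<close>, the union of the generation-\<open>m\<close> cubes inside
  \<open>U\<close>, increases to \<open>U\<close>. Its indicator is constant on those cubes, so its
  averages are exact from generation \<open>m\<close> on. Finite measure of \<open>U\<close> allows
  continuity from above for \<open>U - V m\<close>.\<close>

lemma dyadic_differentiable_indicator_open:
  fixes U :: "'a::euclidean_space set"
  assumes U: "open U" "emeasure lebesgue U < \<infinity>"
  shows "dyadic_differentiable (indicator U)"
proof -
  define V where "V m = {x. dyadic_cube_at (int m) x \<subseteq> U}" for m :: nat
  have sub: "V m \<subseteq> U" for m unfolding V_def using mem_dyadic_cube_at by blast
  have const: "indicator (V m) y = (indicator (V m) x :: complex)"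
    if "y \<in> dyadic_cube_at (int m) x" for x y m
    using that by (simp add: V_def indicator_def flip: dyadic_cube_at_eq_iff)
  \<comment> \<open>Measurability is read off from the indicator, which is constant on the cubes of
    generation \<open>m\<close>.\<close>
  have Vm: "V m \<in> sets lebesgue" for m
  proof -
    have "(indicator (V m) :: 'a \<Rightarrow> complex) \<in> borel_measurable lebesgue"
      by (rule borel_measurable_dyadic_constant) (rule const)
    then show ?thesis by (simp add: borel_measurable_indicator_iff)
  qed
  have Um: "U \<in> sets lebesgue" using U by auto
  have Vfin: "emeasure lebesgue (V m) < \<infinity>" for m
    using emeasure_mono[OF sub Um, of m] U(2) by (simp add: le_less_trans)
  have "dyadic_differentiable (indicator (V m))" for m
    unfolding dyadic_differentiable_def
  proof (intro conjI AE_I2)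
    show "integrable lebesgue (indicator (V m) :: 'a \<Rightarrow> complex)"
      by (rule integrable_complex_indicator[OF Vm Vfin])
    fix x
    have "dyadic_E (int k) (indicator (V m)) x = indicator (V m) x" if "k \<ge> m" for k
      using dyadic_cube_at_nested[of "int m" "int k" x] that
      by (intro dyadic_E_constant_on_cube const) auto
    then show "(\<lambda>k. dyadic_E (int k) (indicator (V m)) x) \<longlonglongrightarrow> indicator (V m) x"
      by (intro tendsto_eventually) (auto simp: eventually_sequentially)
  qed
  moreover have "(\<lambda>m. \<integral>\<^sup>+x. ennreal (cmod (indicator U x - indicator (V m) x)) \<partial>lebesgue) \<longlonglongrightarrow> 0"
  proof -
    have "(\<lambda>m. emeasure lebesgue (U - V m)) \<longlonglongrightarrow> emeasure lebesgue (\<Inter>m. U - V m)"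
    proof (rule Lim_emeasure_decseq)
      show "range (\<lambda>m. U - V m) \<subseteq> sets lebesgue" using Um Vm by auto
      have "V m \<subseteq> V n" if "m \<le> n" for m n
        using dyadic_cube_at_nested[of "int m" "int n"] that unfolding V_def by fastforce
      then show "decseq (\<lambda>m. U - V m)" unfolding decseq_def by blast
      show "emeasure lebesgue (U - V m) \<noteq> \<infinity>" for m
        using emeasure_mono[of "U - V m" U lebesgue] Um U(2) by (auto simp: top_unique)
    qed
    moreover have "(\<Inter>m. U - V m) = {}"
      using dyadic_cube_at_eventually_subset_open[OF U(1)] unfolding V_def by blast
    ultimately show ?thesis
      unfolding nn_integral_cmod_indicator_diff(1)[OF sub sets.Diff[OF Um Vm]] by (simp only: emeasure_empty)
  qed
  ultimately show ?thesis
    by (rule dyadic_differentiable_L1_limit[OF integrable_complex_indicator[OF Um U(2)]])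
qed

lemma dyadic_differentiable_indicator:
  fixes A :: "'a::euclidean_space set"
  assumes A: "A \<in> sets lebesgue" "emeasure lebesgue A < \<infinity>"
  shows "dyadic_differentiable (indicator A)"
proof -
  have "\<exists>T. open T \<and> A \<subseteq> T \<and> T - A \<in> lmeasurable \<and> emeasure lebesgue (T - A) < ennreal (1 / real (Suc n))" for n
    using sets_lebesgue_outer_open[OF A(1), of "1 / real (Suc n)"] by (metis of_nat_0_less_iff zero_less_Suc zero_less_divide_1_iff)
  then obtain T where T: "\<And>n. open (T n)" "\<And>n. A \<subseteq> T n" "\<And>n. T n - A \<in> lmeasurable"
    "\<And>n. emeasure lebesgue (T n - A) < ennreal (1 / real (Suc n))"
    by metis
  \<comment> \<open>The open case asks for finite measure; it is inherited from \<open>A\<close> and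
    the small remainder \<open>T n - A\<close>.\<close>
  have fin: "emeasure lebesgue (T n) < \<infinity>" for n
  proof -
    have "emeasure lebesgue (T n) \<le> emeasure lebesgue A + emeasure lebesgue (T n - A)"
      using emeasure_subadditive[OF A(1), of "T n - A"] T(2)[of n] fmeasurableD[OF T(3)[of n]] by (simp add: Un_absorb1)
    also have "\<dots> < \<infinity>" using A(2) T(3)[of n] by (auto simp: fmeasurable_def)
    finally show ?thesis .
  qed
  have "(\<lambda>n. emeasure lebesgue (T n - A)) \<longlonglongrightarrow> 0"
  proof (rule tendsto_sandwich[where f="\<lambda>_. 0"])
    show "(\<lambda>n. ennreal (1 / real (Suc n))) \<longlonglongrightarrow> 0"
      using tendsto_ennrealI[OF LIMSEQ_inverse_real_of_nat] by (simp add: inverse_eq_divide)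
    show "\<forall>\<^sub>F n in sequentially. emeasure lebesgue (T n - A) \<le> ennreal (1 / real (Suc n))"
      using T(4) less_imp_le by (intro always_eventually allI) blast
  qed auto
  then have "(\<lambda>n. \<integral>\<^sup>+x. ennreal (cmod (indicator A x - indicator (T n) x)) \<partial>lebesgue) \<longlonglongrightarrow> 0"
    using nn_integral_cmod_indicator_diff(2)[OF T(2) fmeasurableD[OF T(3)]] by simp
  then show ?thesis
    by (rule dyadic_differentiable_L1_limit[OF integrable_complex_indicator[OF A]
        dyadic_differentiable_indicator_open[OF T(1) fin]])
qed

theorem integrable_imp_dyadic_differentiable:
  fixes g :: "'a::euclidean_space \<Rightarrow> complex"
  assumes "integrable lebesgue g"
  shows "dyadic_differentiable g"
  using assms
proof (induct rule: integrable_induct)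
  case (base A c)
  have "dyadic_differentiable (indicator A :: 'a \<Rightarrow> complex)"
    by (rule dyadic_differentiable_indicator[OF base])
  then have "dyadic_differentiable (\<lambda>x. c * indicator A x)"
    unfolding dyadic_differentiable_def dyadic_E_cmult by (auto elim!: eventually_mono intro!: tendsto_mult_left)
  moreover have "(\<lambda>x. indicat_real A x *\<^sub>R c) = (\<lambda>x. c * indicator A x)"
    by (auto simp: indicator_def)
  ultimately show ?case by simp
next
  case (add f g)
  have "AE x in lebesgue. (\<lambda>k::nat. dyadic_E (int k) f x) \<longlonglongrightarrow> f x"
    "AE x in lebesgue. (\<lambda>k::nat. dyadic_E (int k) g x) \<longlonglongrightarrow> g x"
    using add by (auto simp: dyadic_differentiable_def)
  then have "AE x in lebesgue. (\<lambda>k::nat. dyadic_E (int k) (\<lambda>x. f x + g x) x) \<longlonglongrightarrow> f x + g x"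
    by eventually_elim (simp add: dyadic_E_add[OF add(1,3)] tendsto_add)
  with add show ?case by (simp add: dyadic_differentiable_def)
next
  case (lim f s)
  have [measurable]: "f \<in> borel_measurable lebesgue" "s i \<in> borel_measurable lebesgue" for i
    using lim by auto
  have "(\<lambda>n. \<integral>\<^sup>+x. ennreal (cmod (f x - s n x)) \<partial>lebesgue) \<longlonglongrightarrow> (\<integral>\<^sup>+(x::'a). 0 \<partial>lebesgue)"
  \<comment> \<open>The factor 3 is 1 + 2: the approximants supplied by
    \<open>integrable_induct\<close> satisfy
    \<open>cmod (s i x) \<le> 2 * cmod (f x)\<close>.\<close>
  proof (rule nn_integral_dominated_convergence[where w="\<lambda>x. ennreal (3 * cmod (f x))" and u'="\<lambda>_. 0"])
    show "AE x in lebesgue. ennreal (cmod (f x - s j x)) \<le> ennreal (3 * cmod (f x))" for j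
    proof (rule AE_I2, rule ennreal_leI)
      fix x show "cmod (f x - s j x) \<le> 3 * cmod (f x)"
        using norm_triangle_ineq4[of "f x" "s j x"] lim(4)[of x j] by simp
    qed
    show "(\<integral>\<^sup>+x. ennreal (3 * cmod (f x)) \<partial>lebesgue) < \<infinity>"
      using integrable_iff_bounded[of lebesgue "\<lambda>x. 3 * f x"] lim(5) by (simp add: norm_mult)
    show "AE x in lebesgue. (\<lambda>i. ennreal (cmod (f x - s i x))) \<longlonglongrightarrow> 0"
    proof (rule AE_I2)
      fix x
      have "(\<lambda>i. cmod (f x - s i x)) \<longlonglongrightarrow> cmod (f x - f x)"
        using lim(3)[of x] by (intro tendsto_intros) auto
      then show "(\<lambda>i. ennreal (cmod (f x - s i x))) \<longlonglongrightarrow> 0"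
        using tendsto_ennrealI by fastforce
    qed
  qed auto
  then have "(\<lambda>n. \<integral>\<^sup>+x. ennreal (cmod (f x - s n x)) \<partial>lebesgue) \<longlonglongrightarrow> 0" by simp
  then show ?case by (rule dyadic_differentiable_L1_limit[OF lim(5,2)])
qed

text \<open>Localization: on a unit cube of generation 0, \<open>g\<close> is integrable, and
  cutting \<open>g\<close> off outside that cube changes no average of generation k >= 0 at its
  points. Countably many unit cubes leave a single null set.\<close>

lemma dyadic_E_tendsto_AE:
  fixes g :: "'a::euclidean_space \<Rightarrow> complex"
  assumes g: "g \<in> L2_space"
  shows "AE x in lebesgue. (\<lambda>k::nat. dyadic_E (int k) g x) \<longlonglongrightarrow> g x"
proof -
  have "dyadic_differentiable (\<lambda>x. indicat_real Q x *\<^sub>R g x)" if "Q \<in> dyadic_cubes 0" for Q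
    using L2_space_set_integrable(1)[OF g lmeasurable_dyadic_cube[OF that]]
    by (intro integrable_imp_dyadic_differentiable) (simp add: set_integrable_def)
  then have "AE x in lebesgue. \<forall>Q\<in>dyadic_cubes 0.
      (\<lambda>k::nat. dyadic_E (int k) (\<lambda>x. indicat_real Q x *\<^sub>R g x) x) \<longlonglongrightarrow> indicat_real Q x *\<^sub>R g x"
    by (intro AE_ball_countable' countable_dyadic_cubes) (auto simp: dyadic_differentiable_def)
  then show ?thesis
  proof eventually_elim
    case (elim x)
    let ?Q = "dyadic_cube_at 0 x"
    have "dyadic_E (int k) (\<lambda>x. indicat_real ?Q x *\<^sub>R g x) x = dyadic_E (int k) g x" for k
    proof -
      have "indicat_real (dyadic_cube_at (int k) x) y *\<^sub>R indicat_real ?Q y *\<^sub>R g y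
          = indicat_real (dyadic_cube_at (int k) x) y *\<^sub>R g y" for y
        using dyadic_cube_at_nested[of 0 "int k" x] by (auto simp: indicator_def)
      then show ?thesis unfolding dyadic_E_def set_lebesgue_integral_def by (simp only:)
    qed
    with elim[rule_format, OF dyadic_cube_at_in_dyadic_cubes, of x] show ?case by simp
  qed
qed

section \<open>Convergence of the twisted expansion\<close>

text \<open>Fatou's lemma as lower semicontinuity of the norm under almost everywhere convergence.
  It is stated with a limit \<open>L\<close> because the Pythagorean identity always supplies
  monotone, hence convergent, norms.\<close>

lemma L2_norm_power2_le_limit:
  fixes u :: "'a::euclidean_space \<Rightarrow> complex"
  assumes u: "u \<in> L2_space" and v: "\<And>n::nat. v n \<in> L2_space"
    and lim: "AE x in lebesgue. (\<lambda>n. v n x) \<longlonglongrightarrow> u x"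
    and L: "(\<lambda>n. (L2_norm (v n))\<^sup>2) \<longlonglongrightarrow> L"
  shows "(L2_norm u)\<^sup>2 \<le> L"
proof -
  have [measurable]: "u \<in> borel_measurable lebesgue" "v n \<in> borel_measurable lebesgue" for n
    using u v by (auto simp: L2_space_def)
  have "L \<ge> 0" using L by (rule LIMSEQ_le_const) auto
  have "ennreal ((L2_norm u)\<^sup>2) = (\<integral>\<^sup>+x. liminf (\<lambda>n. ennreal ((cmod (v n x))\<^sup>2)) \<partial>lebesgue)"
    unfolding ennreal_L2_norm_power2[OF u]
  proof (rule nn_integral_cong_AE, use lim in eventually_elim)
    case (elim x)
    have "(\<lambda>n. ennreal ((cmod (v n x))\<^sup>2)) \<longlonglongrightarrow> ennreal ((cmod (u x))\<^sup>2)"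
      by (intro tendsto_ennrealI tendsto_intros elim)
    then show ?case using lim_imp_Liminf[OF trivial_limit_sequentially] by metis
  qed
  also have "\<dots> \<le> liminf (\<lambda>n. \<integral>\<^sup>+x. ennreal ((cmod (v n x))\<^sup>2) \<partial>lebesgue)"
    by (rule nn_integral_liminf) measurable
  also have "\<dots> = liminf (\<lambda>n. ennreal ((L2_norm (v n))\<^sup>2))"
    by (simp add: ennreal_L2_norm_power2[OF v])
  also have "\<dots> = ennreal L"
    by (rule lim_imp_Liminf[OF trivial_limit_sequentially tendsto_ennrealI[OF L]])
  finally show ?thesis using \<open>L \<ge> 0\<close> by (simp add: ennreal_le_iff)
qed

section \<open>Limits of the averages at the fine and the coarse end\<close>

context
  fixes g :: "'a::euclidean_space \<Rightarrow> complex"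
  assumes g: "g \<in> L2_space"
begin

lemma dyadic_E_norm_mono: "j \<le> k \<Longrightarrow> (L2_norm (dyadic_E j g))\<^sup>2 \<le> (L2_norm (dyadic_E k g))\<^sup>2"
  using dyadic_E_martingale_pythagoras[OF g, of j k] by simp

text \<open>The norms increase to some \<open>L\<close>. Pythagoras gives
  \<open>L \<le> (L2_norm g)\<^sup>2\<close>, Fatou the reverse.\<close>

lemma dyadic_E_norm_tendsto: "(\<lambda>n::nat. (L2_norm (dyadic_E (int n) g))\<^sup>2) \<longlonglongrightarrow> (L2_norm g)\<^sup>2"
proof -
  have le: "(L2_norm (dyadic_E k g))\<^sup>2 \<le> (L2_norm g)\<^sup>2" for k
    using dyadic_E_pythagoras[OF g, of k] by simp
  have "incseq (\<lambda>n::nat. (L2_norm (dyadic_E (int n) g))\<^sup>2)"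
    by (intro incseq_SucI dyadic_E_norm_mono) simp
  then obtain L where L: "(\<lambda>n::nat. (L2_norm (dyadic_E (int n) g))\<^sup>2) \<longlonglongrightarrow> L"
    using incseq_convergent le by metis
  have "(L2_norm g)\<^sup>2 \<le> L"
    by (rule L2_norm_power2_le_limit[OF g dyadic_E_in_L2_space[OF g] dyadic_E_tendsto_AE[OF g] L])
  moreover have "L \<le> (L2_norm g)\<^sup>2" by (rule LIMSEQ_le_const2[OF L]) (use le in auto)
  ultimately show ?thesis using L by simp
qed

lemma dyadic_E_tendsto_L2: "(\<lambda>n::nat. (L2_norm (\<lambda>x. g x - dyadic_E (int n) g x))\<^sup>2) \<longlonglongrightarrow> 0"
proof -
  have "(\<lambda>n::nat. (L2_norm g)\<^sup>2 - (L2_norm (dyadic_E (int n) g))\<^sup>2) \<longlonglongrightarrow> (L2_norm g)\<^sup>2 - (L2_norm g)\<^sup>2"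
    by (intro tendsto_intros dyadic_E_norm_tendsto)
  moreover have "(L2_norm g)\<^sup>2 - (L2_norm (dyadic_E (int n) g))\<^sup>2 = (L2_norm (\<lambda>x. g x - dyadic_E (int n) g x))\<^sup>2" for n
    using dyadic_E_pythagoras[OF g, of "int n"] by simp
  ultimately show ?thesis by simp
qed

lemma dyadic_E_coarse_tendsto: "(\<lambda>n::nat. dyadic_E (- int n) g x) \<longlonglongrightarrow> 0"
proof -
  let ?C = "(L2_norm g)\<^sup>2"
  have "(cmod (dyadic_E (- int n) g x))\<^sup>2 \<le> ?C * (1 / 2) ^ n" for n
  proof -
    have "(cmod (dyadic_E (- int n) g x))\<^sup>2 \<le> ?C / (2 ^ n) ^ DIM('a)"
      using dyadic_E_bound[OF g, of "- int n" x] by simp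
    also have "\<dots> \<le> ?C / 2 ^ n"
      using self_le_power[of "2 ^ n :: real" "DIM('a)"] by (intro divide_left_mono) auto
    finally show ?thesis by (simp add: power_divide)
  qed
  then have "\<forall>\<^sub>F n in sequentially. norm ((cmod (dyadic_E (- int n) g x))\<^sup>2) \<le> ?C * (1 / 2) ^ n"
    by (intro always_eventually allI) simp
  moreover have "(\<lambda>n. ?C * (1 / 2) ^ n) \<longlonglongrightarrow> 0"
    by (intro tendsto_mult_right_zero LIMSEQ_power_zero) simp
  ultimately have "(\<lambda>n. (cmod (dyadic_E (- int n) g x))\<^sup>2) \<longlonglongrightarrow> 0"
    by (rule Lim_null_comparison)
  then have "(\<lambda>n. cmod (dyadic_E (- int n) g x)) \<longlonglongrightarrow> 0"
    using tendsto_real_sqrt[of "\<lambda>n. (cmod (dyadic_E (- int n) g x))\<^sup>2" 0 sequentially] by simp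
  then show ?thesis by (rule tendsto_norm_zero_cancel)
qed

text \<open>The norms decrease to some \<open>L \<ge> 0\<close>. The differences
  \<open>E_0 g - E_{-n} g\<close> tend pointwise to \<open>E_0 g\<close>, and by Pythagoras their
  squared norms tend to that of \<open>E_0 g\<close> minus \<open>L\<close>. Fatou then forces
  \<open>L \<le> 0\<close>.\<close>

lemma dyadic_E_coarse_tendsto_L2: "(\<lambda>n::nat. (L2_norm (dyadic_E (- int n) g))\<^sup>2) \<longlonglongrightarrow> 0"
proof -
  have "decseq (\<lambda>n::nat. (L2_norm (dyadic_E (- int n) g))\<^sup>2)"
    by (intro decseq_SucI dyadic_E_norm_mono) simp
  then obtain L where L: "(\<lambda>n::nat. (L2_norm (dyadic_E (- int n) g))\<^sup>2) \<longlonglongrightarrow> L" and "0 \<le> L"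
    using decseq_convergent[of "\<lambda>n::nat. (L2_norm (dyadic_E (- int n) g))\<^sup>2" 0] LIMSEQ_le_const
    by (metis zero_le_power2)
  note E = dyadic_E_in_L2_space[OF g]
  have "(L2_norm (dyadic_E 0 g))\<^sup>2 \<le> (L2_norm (dyadic_E 0 g))\<^sup>2 - L"
  proof (rule L2_norm_power2_le_limit[OF E])
    show "(\<lambda>x. dyadic_E 0 g x - dyadic_E (- int n) g x) \<in> L2_space" for n
      by (rule L2_space_diff(1)[OF E E])
    show "AE x in lebesgue. (\<lambda>n. dyadic_E 0 g x - dyadic_E (- int n) g x) \<longlonglongrightarrow> dyadic_E 0 g x"
    proof (rule AE_I2)
      fix x
      show "(\<lambda>n. dyadic_E 0 g x - dyadic_E (- int n) g x) \<longlonglongrightarrow> dyadic_E 0 g x"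
        using tendsto_diff[OF tendsto_const dyadic_E_coarse_tendsto, of "dyadic_E 0 g x"] by simp
    qed
    have "(L2_norm (\<lambda>x. dyadic_E 0 g x - dyadic_E (- int n) g x))\<^sup>2
        = (L2_norm (dyadic_E 0 g))\<^sup>2 - (L2_norm (dyadic_E (- int n) g))\<^sup>2" for n
      using dyadic_E_martingale_pythagoras[OF g, of "- int n" 0] by simp
    then show "(\<lambda>n. (L2_norm (\<lambda>x. dyadic_E 0 g x - dyadic_E (- int n) g x))\<^sup>2) \<longlonglongrightarrow> (L2_norm (dyadic_E 0 g))\<^sup>2 - L"
      by (simp add: tendsto_diff[OF tendsto_const L])
  qed
  with \<open>0 \<le> L\<close> L show ?thesis by simp
qed

lemma dyadic_D_L2:
  shows dyadic_D_in_L2_space: "dyadic_D k g \<in> L2_space"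
    and dyadic_D_norm: "(L2_norm (dyadic_D k g))\<^sup>2 = (L2_norm (dyadic_E k g))\<^sup>2 - (L2_norm (dyadic_E (k - 1) g))\<^sup>2"
proof -
  have D: "dyadic_D k g = (\<lambda>x. dyadic_E k g x - dyadic_E (k - 1) g x)"
    by (auto simp: dyadic_D_def)
  show "dyadic_D k g \<in> L2_space"
    unfolding D by (rule L2_space_diff(1)) (rule dyadic_E_in_L2_space[OF g])+
  show "(L2_norm (dyadic_D k g))\<^sup>2 = (L2_norm (dyadic_E k g))\<^sup>2 - (L2_norm (dyadic_E (k - 1) g))\<^sup>2"
    unfolding D using dyadic_E_martingale_pythagoras[OF g, of "k - 1" k] by simp
qed

end

text \<open>The lower end is \<open>- int (Suc N)\<close> because the difference at
  \<open>- int N\<close> reaches one generation further back.\<close>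

lemma sum_int_telescope:
  fixes F :: "int \<Rightarrow> 'b::ab_group_add"
  shows "(\<Sum>k\<in>{- int N..int N}. F k - F (k - 1)) = F (int N) - F (- int (Suc N))"
proof (induction N)
  case (Suc N)
  have "{- int (Suc N)..int (Suc N)} = insert (int (Suc N)) (insert (- int (Suc N)) {- int N..int N})"
    by auto
  then show ?case using Suc.IH by (simp add: algebra_simps)
qed simp

section \<open>The chirp as an isometry, and the twisted expansion\<close>

lemma cmod_chirp [simp]: "cmod (chirp \<alpha> f x) = cmod (f x)"
  and cmod_chirp_inv [simp]: "cmod (chirp_inv \<alpha> f x) = cmod (f x)"
  by (simp_all add: chirp_def chirp_inv_def norm_mult)

lemma chirp_inv_chirp [simp]: "chirp_inv \<alpha> (chirp \<alpha> f) = f"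
  by (auto simp: chirp_def chirp_inv_def simp flip: mult.assoc exp_add)

lemma L2_norm_chirp [simp]: "L2_norm (chirp \<alpha> f) = L2_norm f"
  and L2_norm_chirp_inv [simp]: "L2_norm (chirp_inv \<alpha> f) = L2_norm f"
  by (simp_all add: L2_norm_def)

lemma L2_space_chirp:
  fixes f :: "'a::euclidean_space \<Rightarrow> complex"
  assumes f: "f \<in> L2_space"
  shows "chirp \<alpha> f \<in> L2_space" "chirp_inv \<alpha> f \<in> L2_space"
proof -
  have [measurable]: "f \<in> borel_measurable lebesgue" using f by (simp add: L2_space_def)
  have "(\<lambda>x::'a. exp (c * complex_of_real (pi * (norm x)\<^sup>2 * cot \<alpha>))) \<in> borel_measurable borel" for c
    by (intro borel_measurable_continuous_onI continuous_intros)
  then have [measurable]: "(\<lambda>x::'a. exp (c * complex_of_real (pi * (norm x)\<^sup>2 * cot \<alpha>))) \<in> borel_measurable lebesgue" for c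
    by (intro measurable_completion) simp
  have "chirp \<alpha> f \<in> borel_measurable lebesgue" "chirp_inv \<alpha> f \<in> borel_measurable lebesgue"
    unfolding chirp_def[abs_def] chirp_inv_def[abs_def] by measurable
  then show "chirp \<alpha> f \<in> L2_space" "chirp_inv \<alpha> f \<in> L2_space"
    using f by (auto simp: L2_space_def)
qed

theorem twisted_expansion:
  fixes f :: "'a::euclidean_space \<Rightarrow> complex"
  assumes f: "f \<in> L2_space"
  shows twisted_expansion_AE: "AE x in lebesgue.
      (\<lambda>N::nat. \<Sum>k\<in>{- int N..int N}. twisted_D \<alpha> k f x) \<longlonglongrightarrow> f x"
    and twisted_expansion_L2:
      "L2_tendsto (\<lambda>(N::nat) x. \<Sum>k\<in>{- int N..int N}. twisted_D \<alpha> k f x) f sequentially"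
    and twisted_D_in_L2_space: "\<And>k. twisted_D \<alpha> k f \<in> L2_space"
    and twisted_expansion_norm:
      "(\<lambda>N::nat. \<Sum>k\<in>{- int N..int N}. (L2_norm (twisted_D \<alpha> k f))\<^sup>2) \<longlonglongrightarrow> (L2_norm f)\<^sup>2"
proof -
  define g where "g = chirp \<alpha> f"
  have g: "g \<in> L2_space" unfolding g_def by (rule L2_space_chirp(1)[OF f])
  have f_g: "f x = chirp_inv \<alpha> g x" for x by (simp add: g_def)
  let ?S = "\<lambda>(N::nat) x. dyadic_E (int N) g x - dyadic_E (- int (Suc N)) g x"
  have S: "(\<Sum>k\<in>{- int N..int N}. twisted_D \<alpha> k f x) = chirp_inv \<alpha> (?S N) x" for N x
    using sum_int_telescope[of "\<lambda>k. dyadic_E k g x" N]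
    by (simp add: twisted_D_def chirp_inv_def dyadic_D_def g_def flip: sum_distrib_left)
  show "AE x in lebesgue. (\<lambda>N::nat. \<Sum>k\<in>{- int N..int N}. twisted_D \<alpha> k f x) \<longlonglongrightarrow> f x"
    using dyadic_E_tendsto_AE[OF g]
  proof eventually_elim
    case (elim x)
    \<comment> \<open>\<open>LIMSEQ_Suc\<close> accounts for the lower end
      \<open>- int (Suc N)\<close> of the telescoped sum.\<close>
    have "(\<lambda>N. ?S N x) \<longlonglongrightarrow> g x - 0"
      using elim LIMSEQ_Suc[OF dyadic_E_coarse_tendsto[OF g]] by (rule tendsto_diff)
    then show ?case
      unfolding S f_g chirp_inv_def by (intro tendsto_mult_left) simp
  qed
  note E = dyadic_E_in_L2_space[OF g]
  show "L2_tendsto (\<lambda>(N::nat) x. \<Sum>k\<in>{- int N..int N}. twisted_D \<alpha> k f x) f sequentially"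
  proof -
    \<comment> \<open>The error is the approximation error at the fine end minus the remaining
      coarse average; each tends to 0 in norm separately.\<close>
    let ?d = "\<lambda>N x. (dyadic_E (int N) g x - g x) - dyadic_E (- int (Suc N)) g x"
    have d: "(\<lambda>x. (\<Sum>k\<in>{- int N..int N}. twisted_D \<alpha> k f x) - f x) = chirp_inv \<alpha> (?d N)" for N
      unfolding S f_g by (auto simp: chirp_inv_def algebra_simps)
    have e: "(\<lambda>x. dyadic_E (int N) g x - g x) \<in> L2_space" for N by (rule L2_space_diff(1)[OF E g])
    have "(L2_norm (?d N))\<^sup>2 \<le> 2 * (L2_norm (\<lambda>x. g x - dyadic_E (int N) g x))\<^sup>2
        + 2 * (L2_norm (dyadic_E (- int (Suc N)) g))\<^sup>2" for N
      using L2_space_diff(2)[OF e E, of N "- int (Suc N)"]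
      by (simp add: L2_norm_def norm_minus_commute)
    then have "\<forall>\<^sub>F N in sequentially. norm ((L2_norm (?d N))\<^sup>2) \<le> 2 * (L2_norm (\<lambda>x. g x - dyadic_E (int N) g x))\<^sup>2
        + 2 * (L2_norm (dyadic_E (- int (Suc N)) g))\<^sup>2"
      by (intro always_eventually allI) simp
    moreover have "(\<lambda>N. 2 * (L2_norm (\<lambda>x. g x - dyadic_E (int N) g x))\<^sup>2
        + 2 * (L2_norm (dyadic_E (- int (Suc N)) g))\<^sup>2) \<longlonglongrightarrow> 0"
      by (intro tendsto_add_zero tendsto_mult_right_zero dyadic_E_tendsto_L2[OF g]
          LIMSEQ_Suc[OF dyadic_E_coarse_tendsto_L2[OF g]])
    ultimately have "(\<lambda>N. (L2_norm (?d N))\<^sup>2) \<longlonglongrightarrow> 0"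
      by (rule Lim_null_comparison)
    then have "(\<lambda>N. L2_norm (?d N)) \<longlonglongrightarrow> 0"
      using tendsto_real_sqrt[of "\<lambda>N. (L2_norm (?d N))\<^sup>2" 0 sequentially] by (simp add: L2_norm_def)
    moreover have "chirp_inv \<alpha> (?d N) \<in> L2_space" for N
      by (rule L2_space_chirp(2)[OF L2_space_diff(1)[OF e E]])
    ultimately show ?thesis unfolding L2_tendsto_def d by simp
  qed
  show "twisted_D \<alpha> k f \<in> L2_space" for k
    unfolding twisted_D_def by (rule L2_space_chirp(2)[OF dyadic_D_in_L2_space[OF g, unfolded g_def]])
  have "(\<Sum>k\<in>{- int N..int N}. (L2_norm (twisted_D \<alpha> k f))\<^sup>2) =
      (L2_norm (dyadic_E (int N) g))\<^sup>2 - (L2_norm (dyadic_E (- int (Suc N)) g))\<^sup>2" for N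
    using sum_int_telescope[of "\<lambda>k. (L2_norm (dyadic_E k g))\<^sup>2" N]
    by (simp add: twisted_D_def dyadic_D_norm[OF g] flip: g_def)
  moreover have "(\<lambda>N. (L2_norm (dyadic_E (int N) g))\<^sup>2 - (L2_norm (dyadic_E (- int (Suc N)) g))\<^sup>2)
     \<longlonglongrightarrow> (L2_norm g)\<^sup>2 - 0"
    by (intro tendsto_diff dyadic_E_norm_tendsto[OF g] LIMSEQ_Suc[OF dyadic_E_coarse_tendsto_L2[OF g]])
  ultimately show "(\<lambda>N::nat. \<Sum>k\<in>{- int N..int N}. (L2_norm (twisted_D \<alpha> k f))\<^sup>2) \<longlonglongrightarrow> (L2_norm f)\<^sup>2"
    by (simp add: g_def)
qed

section \<open>The twisted Haar expansion\<close>

text \<open>With \<open>h = 2 powi (- k)\<close>, an interval of generation \<open>k - 1\<close> is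
  \<open>[2mh, (2m+2)h)\<close>. Its halves are the intervals of generation \<open>k\<close> with
  indices \<open>2m\<close> and \<open>2m+1\<close>; the midpoint belongs to the right one.\<close>

lemma dyadic_interval_halves:
  fixes I :: "real set"
  assumes "I \<in> dyadic_cubes (k - 1)"
  shows "left_half I \<in> dyadic_cubes k" "right_half I \<in> dyadic_cubes k"
    "left_half I \<union> right_half I = I" "left_half I \<inter> right_half I = {}"
proof -
  define h :: real where "h = 2 powi (- k)"
  have h: "h > 0" "2 powi (- (k - 1)) = 2 * h"
    by (simp_all add: h_def power_int_diff power_int_minus field_simps)
  \<comment> \<open>On \<open>real\<close> the only basis vector is 1, so an index function enters
    only through the integer \<open>m 1\<close>.\<close>
  have iv: "range (\<lambda>m :: real \<Rightarrow> int. {x::real. \<forall>b\<in>Basis. of_int (m b) * c \<le> x \<bullet> b \<and>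
      x \<bullet> b < (of_int (m b) + 1) * c}) = range (\<lambda>m::int. {of_int m * c..<(of_int m + 1) * c})"
    (is "range ?A = range ?B") for c
  proof -
    have A: "?A m = ?B (m 1)" for m by auto
    have "?B i \<in> range ?A" for i using A[of "\<lambda>_. i"] by (intro image_eqI[of _ _ "\<lambda>_. i"]) auto
    then show ?thesis unfolding A by blast
  qed
  from assms obtain m :: int where m: "I = {of_int m * (2 * h)..<(of_int m + 1) * (2 * h)}"
    unfolding dyadic_cubes_def iv h(2) by blast
  have mid: "(Inf I + Sup I) / 2 = (2 * of_int m + 1) * h"
    using h(1) by (simp add: m algebra_simps)
  have L: "left_half I = {of_int (2 * m) * h..<(of_int (2 * m) + 1) * h}"
    unfolding left_half_def mid using h(1) by (auto simp: m algebra_simps)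
  have R: "right_half I = {of_int (2 * m + 1) * h..<(of_int (2 * m + 1) + 1) * h}"
    unfolding right_half_def mid using h(1) by (auto simp: m algebra_simps)
  show "left_half I \<in> dyadic_cubes k" "right_half I \<in> dyadic_cubes k"
    unfolding dyadic_cubes_def iv h_def[symmetric] L R by blast+
  show "left_half I \<union> right_half I = I" "left_half I \<inter> right_half I = {}"
    by (auto simp: left_half_def right_half_def)
qed

lemma haar_outside: "x \<notin> I \<Longrightarrow> haar I x = 0"
  by (simp add: haar_def left_half_def right_half_def)

lemma cmod_haar_power2: "(cmod (haar I x))\<^sup>2 = indicator I x / measure lebesgue I"
proof -
  have "(cmod (haar I x))\<^sup>2 = (indicator (left_half I) x - indicator (right_half I) x)\<^sup>2 / measure lebesgue I"
    unfolding haar_def norm_of_real power2_abs by (simp add: power_divide)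
  also have "(indicator (left_half I) x - indicator (right_half I) x)\<^sup>2 = indicat_real I x"
    by (auto simp: left_half_def right_half_def indicator_def)
  finally show ?thesis .
qed

lemma integral_mult_haar:
  fixes I :: "real set"
  assumes I: "I \<in> dyadic_cubes (k - 1)" and g: "g \<in> L2_space"
  shows "(LINT y|lebesgue. g y * haar I y) =
    ((LINT y:left_half I|lebesgue. g y) - (LINT y:right_half I|lebesgue. g y)) /
      complex_of_real (sqrt (measure lebesgue I))"
proof -
  note half = dyadic_interval_halves[OF I]
  have L: "set_integrable lebesgue (left_half I) g" "set_integrable lebesgue (right_half I) g"
    using L2_space_set_integrable(1)[OF g lmeasurable_dyadic_cube] half by blast+
  have "g y * haar I y = (indicat_real (left_half I) y *\<^sub>R g y - indicat_real (right_half I) y *\<^sub>R g y)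
      / complex_of_real (sqrt (measure lebesgue I))" for y
    by (simp add: haar_def scaleR_conv_of_real algebra_simps)
  then show ?thesis
    using L by (simp add: set_lebesgue_integral_def set_integrable_def)
qed

text \<open>Let \<open>?L\<close> and \<open>?R\<close> be the integrals of \<open>g\<close> over
  the halves and \<open>m\<close> the length of \<open>I\<close>. On the left half
  \<open>D_k g\<close> is \<open>2 * ?L / m - (?L + ?R) / m = (?L - ?R) / m\<close>, on the right
  half its negative. The Haar coefficient and the Haar function each contribute one factor
  \<open>1 / sqrt m\<close>.\<close>

lemma dyadic_D_eq_haar:
  fixes I :: "real set"
  assumes I: "I \<in> dyadic_cubes (k - 1)" and g: "g \<in> L2_space" and x: "x \<in> I"
  shows "(LINT y|lebesgue. g y * haar I y) * haar I x = dyadic_D k g x"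
proof -
  note half = dyadic_interval_halves[OF I]
  let ?L = "LINT y:left_half I|lebesgue. g y" and ?R = "LINT y:right_half I|lebesgue. g y"
  have S: "set_integrable lebesgue (left_half I) g" "set_integrable lebesgue (right_half I) g"
    using L2_space_set_integrable(1)[OF g lmeasurable_dyadic_cube] half by blast+
  have sum: "(LINT y:I|lebesgue. g y) = ?L + ?R"
    using set_integral_Un[OF half(4) S] half(3) by simp
  define m where "m = measure lebesgue I"
  have m: "m > 0" unfolding m_def by (rule measure_dyadic_cube_pos[OF I])
  have mh: "measure lebesgue Q = m / 2" if "Q \<in> dyadic_cubes k" for Q :: "real set"
    unfolding m_def measure_dyadic_cube[OF that] measure_dyadic_cube[OF I]
    by (simp add: power_int_diff power_int_minus field_simps)
  have sq: "complex_of_real (sqrt m) * complex_of_real (sqrt m) = complex_of_real m"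
    using m by (simp flip: of_real_mult)
  have E1: "dyadic_E (k - 1) g x = (?L + ?R) / complex_of_real m"
    unfolding dyadic_E_on_cube[OF I x] sum m_def ..
  have c: "(LINT y|lebesgue. g y * haar I y) = (?L - ?R) / complex_of_real (sqrt m)"
    unfolding integral_mult_haar[OF I g] m_def ..
  have m0: "complex_of_real m \<noteq> 0" using m by simp
  show ?thesis
  proof (cases "x \<in> left_half I")
    case True
    then have "haar I x = 1 / complex_of_real (sqrt m)"
      using half(4) by (auto simp: haar_def m_def indicator_def)
    then have "(LINT y|lebesgue. g y * haar I y) * haar I x = (?L - ?R) / complex_of_real m"
      unfolding c by (simp add: sq)
    also have "\<dots> = ?L / complex_of_real (m / 2) - (?L + ?R) / complex_of_real m"
      using m0 by (simp add: field_simps)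
    also have "\<dots> = dyadic_D k g x"
      unfolding dyadic_D_def E1 dyadic_E_on_cube[OF half(1) True] mh[OF half(1)] ..
    finally show ?thesis .
  next
    case False
    then have R: "x \<in> right_half I" using half(3) x by auto
    then have "haar I x = - 1 / complex_of_real (sqrt m)"
      using False by (auto simp: haar_def m_def indicator_def)
    then have "(LINT y|lebesgue. g y * haar I y) * haar I x = (?R - ?L) / complex_of_real m"
      unfolding c by (simp add: sq diff_divide_distrib)
    also have "\<dots> = ?R / complex_of_real (m / 2) - (?L + ?R) / complex_of_real m"
      using m0 by (simp add: field_simps)
    also have "\<dots> = dyadic_D k g x"
      unfolding dyadic_D_def E1 dyadic_E_on_cube[OF half(2) R] mh[OF half(2)] ..
    finally show ?thesis .
  qed
qed

text \<open>Conjugation turns the inverse chirp on the Haar function into the chirp on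
  \<open>f\<close>; the Haar function itself is real.\<close>

lemma L2_inner_twisted_haar: "L2_inner f (twisted_haar \<alpha> I) = (LINT y|lebesgue. chirp \<alpha> f y * haar I y)"
  unfolding L2_inner_def twisted_haar_def chirp_inv_def chirp_def
  by (rule Bochner_Integration.integral_cong) (simp_all add: exp_cnj haar_def mult_ac)

lemma twisted_haar_term:
  assumes I: "I \<in> dyadic_cubes (k - 1)" and f: "f \<in> L2_space"
  shows "L2_inner f (twisted_haar \<alpha> I) * twisted_haar \<alpha> I x = (if x \<in> I then twisted_D \<alpha> k f x else 0)"
  using dyadic_D_eq_haar[OF I L2_space_chirp(1)[OF f], of x \<alpha>] haar_outside[of x I]
  unfolding L2_inner_twisted_haar
  unfolding twisted_haar_def twisted_D_def chirp_inv_def mult.left_commute[of _ "exp _"] by auto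

lemma cmod_twisted_haar_power2: "(cmod (twisted_haar \<alpha> I x))\<^sup>2 = indicator I x / measure lebesgue I"
  by (simp add: twisted_haar_def cmod_haar_power2)

text \<open>On \<open>I\<close> the modulus of \<open>twisted_D \<alpha> k f\<close> is constant: it
  is that of the coefficient divided by the square root of the length. Each interval therefore
  contributes exactly one squared coefficient to the norm of
  \<open>twisted_D \<alpha> k f\<close>.\<close>

lemma twisted_haar_coefficient:
  assumes I: "I \<in> dyadic_cubes (k - 1)" and f: "f \<in> L2_space"
  shows "(\<integral>\<^sup>+x\<in>I. ennreal ((cmod (twisted_D \<alpha> k f x))\<^sup>2) \<partial>lebesgue)
      = ennreal ((cmod (L2_inner f (twisted_haar \<alpha> I)))\<^sup>2)"
    and "indicator I x * (cmod (twisted_D \<alpha> k f x))\<^sup>2 =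
      (cmod (L2_inner f (twisted_haar \<alpha> I)))\<^sup>2 / measure lebesgue I * indicator I x"
proof -
  let ?c = "(cmod (L2_inner f (twisted_haar \<alpha> I)))\<^sup>2"
  show eq: "indicator I x * (cmod (twisted_D \<alpha> k f x))\<^sup>2 = ?c / measure lebesgue I * indicator I x" for x
    using arg_cong[OF twisted_haar_term[OF I f, of \<alpha> x], of "\<lambda>z. (cmod z)\<^sup>2"]
    by (cases "x \<in> I") (simp_all add: norm_mult power_mult_distrib cmod_twisted_haar_power2)
  have "(\<integral>\<^sup>+x\<in>I. ennreal ((cmod (twisted_D \<alpha> k f x))\<^sup>2) \<partial>lebesgue)
      = (\<integral>\<^sup>+x. ennreal (?c / measure lebesgue I) * indicator I x \<partial>lebesgue)"
  proof (rule nn_integral_cong)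
    fix x show "ennreal ((cmod (twisted_D \<alpha> k f x))\<^sup>2) * indicator I x
        = ennreal (?c / measure lebesgue I) * indicator I x"
      using eq[of x] by (cases "x \<in> I") simp_all
  qed
  also have "\<dots> = ennreal (?c / measure lebesgue I) * emeasure lebesgue I"
    using sets_dyadic_cube[OF I] by (rule nn_integral_cmult_indicator)
  also have "\<dots> = ennreal (?c / measure lebesgue I) * ennreal (measure lebesgue I)"
    unfolding measure_dyadic_cube[OF I] emeasure_dyadic_cube[OF I] ..
  also have "\<dots> = ennreal ?c"
    using measure_dyadic_cube_pos[OF I] by (simp flip: ennreal_mult)
  finally show "(\<integral>\<^sup>+x\<in>I. ennreal ((cmod (twisted_D \<alpha> k f x))\<^sup>2) \<partial>lebesgue) = ennreal ?c" .
qed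

section \<open>Summation of the Haar terms within and across generations\<close>

lemma has_sum_nn_integral_count_space:
  fixes a :: "'b \<Rightarrow> real"
  assumes "\<And>x. x \<in> A \<Longrightarrow> 0 \<le> a x" "0 \<le> s"
    and "(\<integral>\<^sup>+x. ennreal (a x) \<partial>count_space A) = ennreal s"
  shows "(a has_sum s) A"
proof -
  \<comment> \<open>The passage to \<open>has_sum\<close> goes through \<open>infsetsum\<close>, the
    sum defined as an integral over \<open>count_space\<close>.\<close>
  have "integrable (count_space A) a"
    using assms by (intro integrableI_nonneg) (auto simp: AE_count_space)
  then have *: "Infinite_Set_Sum.abs_summable_on a A" by (simp add: Infinite_Set_Sum.abs_summable_on_def)
  then have "a summable_on A"
    by (rule abs_summable_summable[OF iffD2[OF abs_summable_equivalent]])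
  moreover have "infsum a A = s"
    using infsetsum_infsum[OF *] infsetsum_conv_nn_integral[of A a] assms by simp
  ultimately show ?thesis using has_sum_infsum by blast
qed

lemma twisted_haar_parseval_generation:
  assumes f: "f \<in> L2_space"
  shows "((\<lambda>I. (cmod (L2_inner f (twisted_haar \<alpha> I)))\<^sup>2) has_sum (L2_norm (twisted_D \<alpha> k f))\<^sup>2)
    (dyadic_cubes (k - 1))"
proof (rule has_sum_nn_integral_count_space)
  note D = twisted_D_in_L2_space[OF f, of \<alpha> k]
  have "ennreal ((L2_norm (twisted_D \<alpha> k f))\<^sup>2) = (\<integral>\<^sup>+I. (\<integral>\<^sup>+x\<in>I. ennreal ((cmod (twisted_D \<alpha> k f x))\<^sup>2) \<partial>lebesgue)
      \<partial>count_space (dyadic_cubes (k - 1)))"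
    unfolding ennreal_L2_norm_power2[OF D]
    using L2_space_measurable[OF D] by (intro nn_integral_dyadic_cubes) measurable
  also have "\<dots> = (\<integral>\<^sup>+I. ennreal ((cmod (L2_inner f (twisted_haar \<alpha> I)))\<^sup>2) \<partial>count_space (dyadic_cubes (k - 1)))"
    by (rule nn_integral_cong) (simp add: twisted_haar_coefficient(1)[OF _ f])
  finally show "(\<integral>\<^sup>+I. ennreal ((cmod (L2_inner f (twisted_haar \<alpha> I)))\<^sup>2) \<partial>count_space (dyadic_cubes (k - 1)))
    = ennreal ((L2_norm (twisted_D \<alpha> k f))\<^sup>2)" ..
qed auto

text \<open>At a given x only the interval of that generation containing x can contribute a nonzero
  term.\<close>

lemma twisted_haar_has_sum_pointwise:
  assumes f: "f \<in> L2_space"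
  shows "((\<lambda>I. L2_inner f (twisted_haar \<alpha> I) * twisted_haar \<alpha> I x) has_sum twisted_D \<alpha> k f x)
    (dyadic_cubes (k - 1))"
proof (rule has_sum_finite_neutralI[where B="{dyadic_cube_at (k - 1) x}"])
  show "L2_inner f (twisted_haar \<alpha> I) * twisted_haar \<alpha> I x = 0"
    if "I \<in> dyadic_cubes (k - 1) - {dyadic_cube_at (k - 1) x}" for I
    using that dyadic_cube_at_eqI[of I "k - 1" x] twisted_haar_term[OF _ f, of I k \<alpha> x] by auto
qed (simp_all add: dyadic_cube_at_in_dyadic_cubes
    twisted_haar_term[OF dyadic_cube_at_in_dyadic_cubes f])

text \<open>A finite partial sum is \<open>twisted_D \<alpha> k f\<close> restricted to the union of
  the chosen intervals. Its squared error is the total squared norm minus the chosen squared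
  coefficients, which tends to 0 by Parseval on one generation.\<close>

lemma twisted_haar_tendsto_L2:
  assumes f: "f \<in> L2_space"
  shows "L2_tendsto (\<lambda>F x. \<Sum>I\<in>F. L2_inner f (twisted_haar \<alpha> I) * twisted_haar \<alpha> I x)
    (twisted_D \<alpha> k f) (finite_subsets_at_top (dyadic_cubes (k - 1)))"
proof -
  let ?c = "\<lambda>I. (cmod (L2_inner f (twisted_haar \<alpha> I)))\<^sup>2"
  let ?S = "\<lambda>F x. \<Sum>I\<in>F. L2_inner f (twisted_haar \<alpha> I) * twisted_haar \<alpha> I x"
  let ?D = "twisted_D \<alpha> k f"
  note D = twisted_D_in_L2_space[OF f, of \<alpha> k]
  have [measurable]: "?D \<in> borel_measurable lebesgue" by (rule L2_space_measurable[OF D])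
  have *: "(\<lambda>x. ?S F x - ?D x) \<in> L2_space"
    "(L2_norm (\<lambda>x. ?S F x - ?D x))\<^sup>2 = (L2_norm ?D)\<^sup>2 - (\<Sum>I\<in>F. ?c I)"
    if F: "finite F" "F \<subseteq> dyadic_cubes (k - 1)" for F
  proof -
    have Fm [measurable]: "I \<in> sets lebesgue" if "I \<in> F" for I using F that sets_dyadic_cube by blast
    have S: "?S F x = (\<Sum>I\<in>F. if x \<in> I then ?D x else 0)" for x
      using F by (intro sum.cong refl twisted_haar_term[OF _ f]) auto
    \<comment> \<open>At most one member of \<open>F\<close> contains x. It is used twice: for the
      complex partial sum and for the sum of squared moduli.\<close>
    have part: "(\<Sum>I\<in>F. if x \<in> I then y else 0) = (if dyadic_cube_at (k - 1) x \<in> F then y else 0)"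
      for x and y :: "'c::comm_monoid_add"
    proof -
      have "(\<Sum>I\<in>F. if x \<in> I then y else 0) = (\<Sum>I\<in>F. if I = dyadic_cube_at (k - 1) x then y else 0)"
        using F dyadic_cube_at_eqI[of _ "k - 1" x] by (intro sum.cong) auto
      then show ?thesis using F by simp
    qed
    have pt: "(cmod (?S F x - ?D x))\<^sup>2 = (cmod (?D x))\<^sup>2 - (\<Sum>I\<in>F. ?c I / measure lebesgue I * indicator I x)" for x
    proof -
      have "(\<Sum>I\<in>F. ?c I / measure lebesgue I * indicator I x) = (\<Sum>I\<in>F. indicator I x * (cmod (?D x))\<^sup>2)"
        using F by (intro sum.cong) (auto simp: twisted_haar_coefficient(2)[OF _ f])
      also have "\<dots> = (\<Sum>I\<in>F. if x \<in> I then (cmod (?D x))\<^sup>2 else 0)"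
        by (intro sum.cong) auto
      finally show ?thesis unfolding S part by simp
    qed
    have int: "integrable lebesgue (\<lambda>x. ?c I / measure lebesgue I * indicator I x)" if "I \<in> F" for I
      using F that lmeasurable_dyadic_cube[of I "k - 1"]
      by (intro integrable_mult_right integrable_real_indicator) (auto simp: fmeasurable_def)
    have sum_int: "integrable lebesgue (\<lambda>x. \<Sum>I\<in>F. ?c I / measure lebesgue I * indicator I x)"
      by (intro Bochner_Integration.integrable_sum int)
    have sum_eq: "(LINT x|lebesgue. (\<Sum>I\<in>F. ?c I / measure lebesgue I * indicator I x))
        = (\<Sum>I\<in>F. LINT x|lebesgue. ?c I / measure lebesgue I * indicator I x)"
      by (intro Bochner_Integration.integral_sum int)
    have "integrable lebesgue (\<lambda>x. (cmod (?S F x - ?D x))\<^sup>2)"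
      unfolding pt by (intro Bochner_Integration.integrable_diff sum_int L2_space_integrable[OF D])
    moreover have "(\<lambda>x. ?S F x - ?D x) \<in> borel_measurable lebesgue"
      unfolding S by measurable
    ultimately show "(\<lambda>x. ?S F x - ?D x) \<in> L2_space" by (simp add: L2_space_def)
    have "(L2_norm (\<lambda>x. ?S F x - ?D x))\<^sup>2 = (L2_norm ?D)\<^sup>2
        - (\<Sum>I\<in>F. LINT x|lebesgue. ?c I / measure lebesgue I * indicator I x)"
      unfolding L2_norm_power2 pt
      unfolding Bochner_Integration.integral_diff[OF L2_space_integrable[OF D] sum_int] sum_eq ..
    also have "(\<Sum>I\<in>F. LINT x|lebesgue. ?c I / measure lebesgue I * indicator I x) = (\<Sum>I\<in>F. ?c I)"
    proof (rule sum.cong)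
      fix I assume "I \<in> F"
      then have I: "I \<in> dyadic_cubes (k - 1)" using F by auto
      have "(LINT x|lebesgue. ?c I / measure lebesgue I * indicator I x) = ?c I / measure lebesgue I * measure lebesgue I"
        using Fm[OF \<open>I \<in> F\<close>] by simp
      then show "(LINT x|lebesgue. ?c I / measure lebesgue I * indicator I x) = ?c I"
        using measure_dyadic_cube_pos[OF I] by simp
    qed simp
    finally show "(L2_norm (\<lambda>x. ?S F x - ?D x))\<^sup>2 = (L2_norm ?D)\<^sup>2 - (\<Sum>I\<in>F. ?c I)" .
  qed
  have ev: "\<forall>\<^sub>F F in finite_subsets_at_top (dyadic_cubes (k - 1)). finite F \<and> F \<subseteq> dyadic_cubes (k - 1)"
    by (rule eventually_finite_subsets_at_top_weakI) simp
  have "((\<lambda>F. (L2_norm ?D)\<^sup>2 - (\<Sum>I\<in>F. ?c I)) \<longlongrightarrow> (L2_norm ?D)\<^sup>2 - (L2_norm ?D)\<^sup>2)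
      (finite_subsets_at_top (dyadic_cubes (k - 1)))"
    using twisted_haar_parseval_generation[OF f, of \<alpha> k] unfolding has_sum_def by (intro tendsto_intros)
  then have "((\<lambda>F. (L2_norm (\<lambda>x. ?S F x - ?D x))\<^sup>2) \<longlongrightarrow> 0) (finite_subsets_at_top (dyadic_cubes (k - 1)))"
    by (subst tendsto_cong[OF eventually_mono[OF ev]]) (use *(2) in auto)
  then have "((\<lambda>F. L2_norm (\<lambda>x. ?S F x - ?D x)) \<longlongrightarrow> 0) (finite_subsets_at_top (dyadic_cubes (k - 1)))"
    using tendsto_real_sqrt[of "\<lambda>F. (L2_norm (\<lambda>x. ?S F x - ?D x))\<^sup>2" 0] by (simp add: L2_norm_def)
  moreover have "\<forall>\<^sub>F F in finite_subsets_at_top (dyadic_cubes (k - 1)). (\<lambda>x. ?S F x - ?D x) \<in> L2_space"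
    using ev by eventually_elim (use *(1) in blast)
  ultimately show ?thesis unfolding L2_tendsto_def by simp
qed

text \<open>For nonnegative terms, convergence along the symmetric windows bounds all finite sums
  and is therefore unconditional.\<close>

lemma has_sum_int_symmetric:
  fixes a :: "int \<Rightarrow> real"
  assumes nonneg: "\<And>k. 0 \<le> a k" and lim: "(\<lambda>N::nat. \<Sum>k\<in>{- int N..int N}. a k) \<longlonglongrightarrow> s"
  shows "(a has_sum s) UNIV"
proof -
  have sub: "\<exists>N::nat. X \<subseteq> {- int N..int N}" if "finite X" for X
  proof -
    \<comment> \<open>The sum of the absolute values bounds every element and, unlike a maximum, is
      meaningful for the empty set.\<close>
    define N where "N = (\<Sum>x\<in>X. nat \<bar>x\<bar>)"
    have "X \<subseteq> {- int N..int N}"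
    proof
      fix x assume "x \<in> X"
      then have "nat \<bar>x\<bar> \<le> N" unfolding N_def using that by (intro member_le_sum) auto
      then show "x \<in> {- int N..int N}" by auto
    qed
    then show ?thesis by blast
  qed
  have inc: "incseq (\<lambda>N::nat. \<Sum>k\<in>{- int N..int N}. a k)"
    by (intro incseq_SucI sum_mono2) (auto simp: nonneg)
  have "sum a X \<le> s" if "finite X" for X
  proof -
    obtain N :: nat where "X \<subseteq> {- int N..int N}" using sub[OF \<open>finite X\<close>] by blast
    then have "sum a X \<le> (\<Sum>k\<in>{- int N..int N}. a k)" by (intro sum_mono2) (auto simp: nonneg)
    also have "\<dots> \<le> s" by (rule incseq_le[OF inc lim])
    finally show ?thesis .
  qed
  then have "a summable_on UNIV"
    by (intro nonneg_bdd_above_summable_on nonneg) (auto simp: bdd_above_def)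
  then obtain t where t: "(a has_sum t) UNIV" by (auto simp: summable_on_def)
  \<comment> \<open>The windows eventually contain any finite set, so the unconditional sum
    \<open>t\<close> is also their limit and agrees with \<open>s\<close>.\<close>
  have "filterlim (\<lambda>N::nat. {- int N..int N}) (finite_subsets_at_top UNIV) sequentially"
    unfolding filterlim_finite_subsets_at_top
  proof (intro allI impI)
    fix X :: "int set" assume "finite X \<and> X \<subseteq> UNIV"
    then obtain N :: nat where N: "X \<subseteq> {- int N..int N}" using sub by blast
    show "\<forall>\<^sub>F n in sequentially. finite {- int n..int n} \<and> X \<subseteq> {- int n..int n} \<and> {- int n..int n} \<subseteq> UNIV"
      using eventually_ge_at_top[of N] by eventually_elim (use N in fastforce)
  qed
  with t have "(\<lambda>N::nat. \<Sum>k\<in>{- int N..int N}. a k) \<longlonglongrightarrow> t"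
    unfolding has_sum_def by (rule filterlim_compose)
  then show ?thesis using lim t LIMSEQ_unique by blast
qed

text \<open>The measure of a cube determines its generation. Hence no interval is counted twice when
  the generations are united.\<close>

lemma dyadic_cubes_generation_unique:
  fixes Q :: "'a::euclidean_space set"
  assumes "Q \<in> dyadic_cubes j" "Q \<in> dyadic_cubes k"
  shows "j = k"
proof -
  have lt: False if "i < l" "Q \<in> dyadic_cubes i" "Q \<in> dyadic_cubes l" for i l
  proof -
    have "(2::real) powi (- l) < 2 powi (- i)"
      using that(1) by (intro power_int_strict_increasing) auto
    then have "((2::real) powi (- l)) ^ DIM('a) < (2 powi (- i)) ^ DIM('a)"
      by (intro power_strict_mono) auto
    then show False using measure_dyadic_cube[OF that(2)] measure_dyadic_cube[OF that(3)] by simp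
  qed
  show ?thesis using lt[of j k] lt[of k j] assms by (cases j k rule: linorder_cases) auto
qed

text \<open>The sum is first taken over pairs \<open>(k, I)\<close>. Each generation sums to a
  squared norm of \<open>twisted_D\<close>, and these add up to that of \<open>f\<close>. Projecting
  the pairs to \<open>I\<close> is a bijection onto all dyadic intervals.\<close>

lemma twisted_haar_parseval:
  assumes f: "f \<in> L2_space"
  shows "((\<lambda>I. (cmod (L2_inner f (twisted_haar \<alpha> I)))\<^sup>2) has_sum (L2_norm f)\<^sup>2) (\<Union>k. dyadic_cubes k)"
proof -
  let ?c = "\<lambda>I. (cmod (L2_inner f (twisted_haar \<alpha> I)))\<^sup>2"
  have gen: "((\<lambda>I. ?c (snd (k, I))) has_sum (L2_norm (twisted_D \<alpha> k f))\<^sup>2) (dyadic_cubes (k - 1))" for k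
    using twisted_haar_parseval_generation[OF f, of \<alpha> k] by simp
  have tot: "((\<lambda>k. (L2_norm (twisted_D \<alpha> k f))\<^sup>2) has_sum (L2_norm f)\<^sup>2) UNIV"
    by (rule has_sum_int_symmetric[OF _ twisted_expansion_norm[OF f]]) simp
  have "(\<lambda>p. ?c (snd p)) summable_on Sigma UNIV (\<lambda>k. dyadic_cubes (k - 1))"
    by (rule summable_on_SigmaI[OF gen]) (use tot in \<open>auto simp: summable_on_def\<close>)
  with gen tot have "((\<lambda>p. ?c (snd p)) has_sum (L2_norm f)\<^sup>2) (Sigma UNIV (\<lambda>k. dyadic_cubes (k - 1)))"
    by (intro has_sum_SigmaI) auto
  moreover have "bij_betw snd (Sigma UNIV (\<lambda>k. dyadic_cubes (k - 1))) (\<Union>k. dyadic_cubes k :: real set set)"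
    unfolding bij_betw_def
  proof
    show "inj_on snd (Sigma UNIV (\<lambda>k. dyadic_cubes (k - 1) :: real set set))"
      using dyadic_cubes_generation_unique by (fastforce intro!: inj_onI)
    show "snd ` (Sigma UNIV (\<lambda>k. dyadic_cubes (k - 1))) = (\<Union>k. dyadic_cubes k :: real set set)"
    proof (intro equalityI subsetI)
      fix I :: "real set" assume "I \<in> (\<Union>k. dyadic_cubes k)"
      then obtain k where "I \<in> dyadic_cubes k" by blast
      then show "I \<in> snd ` (Sigma UNIV (\<lambda>k. dyadic_cubes (k - 1)))"
        \<comment> \<open>The shift is needed because the pairs carry the index of
          \<open>twisted_D\<close>, whose Haar intervals lie one generation below.\<close>
        by (intro image_eqI[of _ _ "(k + 1, I)"]) simp_all
    qed auto
  qed
  ultimately show ?thesis using has_sum_reindex_bij_betw[where f = ?c] by blast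
qed

theorem theorem7p4:
  fixes \<alpha> :: real
  assumes "\<nexists>j::int. \<alpha> = of_int j * pi"
  shows "(\<forall>f :: real ^ 'n \<Rightarrow> complex. f \<in> L2_space \<longrightarrow>
           (AE x in lebesgue.
              (\<lambda>N::nat. \<Sum>k\<in>{- int N..int N}. twisted_D \<alpha> k f x) \<longlonglongrightarrow> f x) \<and>
           L2_tendsto (\<lambda>(N::nat) x. \<Sum>k\<in>{- int N..int N}. twisted_D \<alpha> k f x) f sequentially \<and>
           (\<forall>k. twisted_D \<alpha> k f \<in> L2_space) \<and>
           (\<lambda>N::nat. \<Sum>k\<in>{- int N..int N}. (L2_norm (twisted_D \<alpha> k f))\<^sup>2) \<longlonglongrightarrow> (L2_norm f)\<^sup>2) \<and>
         (\<forall>f :: real \<Rightarrow> complex. f \<in> L2_space \<longrightarrow>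
           (\<forall>k x. ((\<lambda>I. L2_inner f (twisted_haar \<alpha> I) * twisted_haar \<alpha> I x)
                     has_sum twisted_D \<alpha> k f x) (dyadic_cubes (k - 1))) \<and>
           (\<forall>k. L2_tendsto
                  (\<lambda>F x. \<Sum>I\<in>F. L2_inner f (twisted_haar \<alpha> I) * twisted_haar \<alpha> I x)
                  (twisted_D \<alpha> k f) (finite_subsets_at_top (dyadic_cubes (k - 1)))) \<and>
           (AE x in lebesgue.
              (\<lambda>N::nat. \<Sum>k\<in>{- int N..int N}. \<Sum>\<^sub>\<infinity>I\<in>dyadic_cubes (k - 1).
                 L2_inner f (twisted_haar \<alpha> I) * twisted_haar \<alpha> I x) \<longlonglongrightarrow> f x) \<and>
           L2_tendsto
             (\<lambda>(N::nat) x. \<Sum>k\<in>{- int N..int N}. \<Sum>\<^sub>\<infinity>I\<in>dyadic_cubes (k - 1).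
                L2_inner f (twisted_haar \<alpha> I) * twisted_haar \<alpha> I x) f sequentially \<and>
           ((\<lambda>I. (cmod (L2_inner f (twisted_haar \<alpha> I)))\<^sup>2)
              has_sum (L2_norm f)\<^sup>2) (\<Union>k. dyadic_cubes k))"
proof -
  \<comment> \<open>Each inner infinite sum equals \<open>twisted_D \<alpha> k f x\<close> at every
    x, so the expansion over intervals is the general expansion on \<open>real\<close>.\<close>
  have haar_sum: "(\<Sum>\<^sub>\<infinity>I\<in>dyadic_cubes (k - 1). L2_inner f (twisted_haar \<alpha> I) * twisted_haar \<alpha> I x)
      = twisted_D \<alpha> k f x" if "f \<in> L2_space" for f k x
    by (rule infsumI[OF twisted_haar_has_sum_pointwise[OF that]])
  show ?thesis
    by (intro conjI allI impI twisted_expansion_AE twisted_expansion_L2 twisted_D_in_L2_space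
        twisted_expansion_norm twisted_haar_has_sum_pointwise twisted_haar_tendsto_L2 twisted_haar_parseval)
      (simp_all add: haar_sum twisted_expansion_AE twisted_expansion_L2)
qed

end
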